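(* Let $k\ge 3$ and $d$ be integers with $0\le d<k/2$. Then for each $\varepsilon>0$ there is a constant $c=c(\varepsilon,k,d)$ such that for all real $X\ge 1$, \[ |I_{k,d}(X)-T_k(X)|\le c\,X^{\gamma_{k,d}+\varepsilon}, \] where \[ \gamma_{k,d}=\min_{2\le r\le k}\biggl( r+\frac{k}{r}+\sum_{l=1}^r\max\{d-l+1,0\}\biggr). \]
   Context: For integers $k\ge 2$, $0\le d<k$ and real $X\ge 1$, $I_{k,d}(X)$ denotes the number of pairs of integer $k$-tuples $(x_1,\dots,x_k)$, $(y_1,\dots,y_k)$ with $1\le x_i,y_i\le X$ for all $i$ satisfying the system $x_1^j+\dots+x_k^j=y_1^j+\dots+y_k^j$ for all $j$ with $1\le j\le k$, $j\ne k-d$. $T_k(X)$ denotes the number of pairs of integer $k$-tuples $\mathbf{x},\mathbf{y}$ with $1\le x_i,y_i\le X$ such that $(x_1,\dots,x_k)$ is a permutation of $(y_1,\dots,y_k)$. *)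

theory Defs
  imports Complex_Main "HOL-Library.FuncSet" "HOL-Combinatorics.Permutations"
begin

text \<open>
  An integer \<open>k\<close>-tuple \<open>(x\<^sub>1, \<dots>, x\<^sub>k)\<close> is a function on the index set \<open>{1..k}\<close>,
  extensional outside it (\<open>PiE\<close>), so that the sets below are finite and counted by \<open>card\<close>.
\<close>

definition box_tuples :: "nat \<Rightarrow> real \<Rightarrow> (nat \<Rightarrow> int) set" where
  "box_tuples k X = {1..k} \<rightarrow>\<^sub>E {n :: int. 1 \<le> n \<and> real_of_int n \<le> X}"

definition I_count :: "nat \<Rightarrow> nat \<Rightarrow> real \<Rightarrow> nat" where
  "I_count k d X = card {(x, y). x \<in> box_tuples k X \<and> y \<in> box_tuples k X \<and>
     (\<forall>j. 1 \<le> j \<and> j \<le> k \<and> j \<noteq> k - d \<longrightarrow> (\<Sum>i = 1..k. x i ^ j) = (\<Sum>i = 1..k. y i ^ j))}"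

definition T_count :: "nat \<Rightarrow> real \<Rightarrow> nat" where
  "T_count k X = card {(x, y). x \<in> box_tuples k X \<and> y \<in> box_tuples k X \<and>
     (\<exists>\<sigma>. \<sigma> permutes {1..k} \<and> (\<forall>i \<in> {1..k}. x i = y (\<sigma> i)))}"

definition gamma_exp :: "nat \<Rightarrow> nat \<Rightarrow> real" where
  "gamma_exp k d = (MIN r \<in> {2..k}.
     real r + real k / real r + (\<Sum>l = 1..r. max (real d - real l + 1) 0))"

end

theory Submission
  imports Defs "HOL-Computational_Algebra.Computational_Algebra"
begin

text \<open>
  Write \<open>P\<^sub>x(z) = \<Prod>(z - x\<^sub>i)\<close>. Since \<open>2 d < k\<close>, Newton's identities give \<open>P\<^sub>x - P\<^sub>y = h q\<close>
  with \<open>q\<close> the monic polynomial of degree \<open>d\<close> formed by the leading coefficients of \<open>P\<^sub>x\<close>,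
  and \<open>h \<noteq> 0\<close> off the diagonal.
  Hence \<open>\<Prod>(z - x\<^sub>i) = h q(z)\<close> for every value \<open>z\<close> of \<open>y\<close>. Take \<open>r\<close> such values that are not
  values of \<open>x\<close>. Splitting the prime factors of \<open>h\<close> among the factors \<open>z - x\<^sub>i\<close> yields one value
  \<open>z0\<close> and some \<open>B \<le> X powr (k / r)\<close> such that each \<open>z0 - x\<^sub>s\<close> divides a nonzero integer
  determined by the \<open>r\<close> values, \<open>B\<close>, \<open>q(z0)\<close> and \<open>x\<^sub>1, \<dots>, x\<^sub>s\<^sub>-\<^sub>1\<close>. By the divisor bound there are
  \<open>O(X powr \<epsilon>)\<close> choices for each \<open>x\<^sub>s\<close> in turn, and then boundedly many for \<open>y\<close>.
  The resulting exponent \<open>r + d + k / r + \<epsilon>\<close> suffices, as \<open>d\<close> is the term \<open>l = 1\<close> of the sum in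
  \<open>\<gamma>\<close>. If fewer than \<open>r\<close> such values exist, \<open>y\<close> has fewer than \<open>r + d\<close> distinct
  values, because the common values are roots of \<open>q\<close>, and a trivial count is enough.
\<close>

subsection \<open>Newton identities with a missing power sum\<close>

text \<open>The logarithmic derivative of \<open>\<Prod>(1 - x_i t)\<close> is
  \<open>- \<Sum> x_i / (1 - x_i t)\<close>, whose coefficients are negated power sums. The
  multiplied-out form avoids division over the integers and follows from the product rule by
  induction.\<close>

lemma fps_deriv_prod_linear:
  fixes x :: "'a \<Rightarrow> int"
  assumes "finite S"
  shows "fps_deriv (\<Prod>i\<in>S. 1 - fps_const (x i) * fps_X) =
    - (\<Prod>i\<in>S. 1 - fps_const (x i) * fps_X) * Abs_fps (\<lambda>n. \<Sum>i\<in>S. x i ^ Suc n)"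
  using assms
proof (induction S rule: finite_induct)
  case empty
  have "Abs_fps (\<lambda>n. \<Sum>i\<in>{}. x i ^ Suc n) = 0"
    by (simp add: fps_eq_iff)
  then show ?case by simp
next
  case (insert j S)
  define P where "P = (\<Prod>i\<in>S. 1 - fps_const (x i) * fps_X)"
  define F where "F = Abs_fps (\<lambda>n. \<Sum>i\<in>S. x i ^ Suc n)"
  define G where "G = Abs_fps (\<lambda>n. x j ^ Suc n)"
  have GF: "Abs_fps (\<lambda>n. \<Sum>i\<in>insert j S. x i ^ Suc n) = G + F"
    using insert.hyps by (simp add: fps_eq_iff G_def F_def)
  \<comment> \<open>\<open>G\<close> is the geometric series
    \<open>x_j / (1 - x_j t)\<close>.\<close>
  have G: "(1 - fps_const (x j) * fps_X) * G = fps_const (x j)"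
  proof (rule fps_ext)
    fix n show "fps_nth ((1 - fps_const (x j) * fps_X) * G) n = fps_nth (fps_const (x j)) n"
      by (cases n) (simp_all add: G_def algebra_simps)
  qed
  have IH: "fps_deriv P = - P * F"
    using insert.IH by (simp add: P_def F_def)
  have "fps_deriv ((1 - fps_const (x j) * fps_X) * P) =
      - (1 - fps_const (x j) * fps_X) * P * F - P * fps_const (x j)"
    by (simp add: IH algebra_simps)
  also have "\<dots> = - (1 - fps_const (x j) * fps_X) * P * F
      - P * ((1 - fps_const (x j) * fps_X) * G)"
    by (simp only: G)
  also have "\<dots> = - ((1 - fps_const (x j) * fps_X) * P) * (G + F)"
    by (simp add: algebra_simps)
  finally show ?case
    using insert.hyps unfolding GF by (simp add: P_def)
qed

text \<open>This is \<open>P_x\<close> of the overview; a general index set allows induction over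
  the factors.\<close>

definition root_poly :: "'a set \<Rightarrow> ('a \<Rightarrow> int) \<Rightarrow> int poly" where
  "root_poly S x = (\<Prod>i\<in>S. [:- x i, 1:])"

lemma poly_root_poly: "poly (root_poly S x) z = (\<Prod>i\<in>S. z - x i)"
  by (simp add: root_poly_def poly_prod)

lemma poly_root_poly_eq_0_iff: "finite S \<Longrightarrow> poly (root_poly S x) z = 0 \<longleftrightarrow> z \<in> x ` S"
  by (auto simp: poly_root_poly)

lemma degree_root_poly: "degree (root_poly S x) = card S"
proof (cases "finite S")
  case True
  then show ?thesis
    unfolding root_poly_def by (subst degree_prod_eq_sum_degree) auto
qed (simp add: root_poly_def)

lemma lead_coeff_root_poly: "coeff (root_poly S x) (card S) = 1"
proof -
  have "lead_coeff (root_poly S x) = 1"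
    unfolding root_poly_def by (simp add: lead_coeff_prod)
  then show ?thesis by (simp add: degree_root_poly)
qed

text \<open>Coefficients of \<open>t ^ n\<close> are compared in the logarithmic derivative.
  \<open>reflect_poly\<close> turns \<open>\<Prod>(z - x_i)\<close> into
  \<open>\<Prod>(1 - x_i t)\<close>, so for \<open>n \<le> card S\<close> the number
  \<open>a n\<close> is the coefficient of \<open>z ^ (card S - n)\<close>.\<close>

lemma newton_identity:
  fixes x :: "'a \<Rightarrow> int"
  assumes S: "finite S"
  defines "a \<equiv> coeff (reflect_poly (root_poly S x))"
  shows "int (Suc n) * a (Suc n) = - (\<Sum>i=0..n. a i * (\<Sum>j\<in>S. x j ^ (Suc n - i)))"
proof -
  define A where "A = (\<Prod>i\<in>S. 1 - fps_const (x i) * fps_X)"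
  have lin: "fps_of_poly (reflect_poly [:- c, 1:]) = 1 - fps_const c * fps_X" for c :: int
    by (simp add: reflect_poly_pCons' monom_Suc monom_0 fps_of_poly_pCons)
  have "fps_of_poly (reflect_poly (root_poly S x)) = A"
    by (simp add: root_poly_def A_def reflect_poly_prod fps_of_poly_prod lin)
  then have a: "a = fps_nth A"
    by (auto simp: a_def)
  have "fps_nth (fps_deriv A) n = fps_nth (- A * Abs_fps (\<lambda>n. \<Sum>i\<in>S. x i ^ Suc n)) n"
    unfolding A_def by (subst fps_deriv_prod_linear[OF S]) simp
  moreover have "fps_nth (- A * Abs_fps (\<lambda>n. \<Sum>i\<in>S. x i ^ Suc n)) n =
      - (\<Sum>i=0..n. a i * (\<Sum>j\<in>S. x j ^ Suc (n - i)))"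
    by (simp add: fps_mult_nth a sum_negf)
  moreover have "(\<Sum>i=0..n. a i * (\<Sum>j\<in>S. x j ^ Suc (n - i))) =
      (\<Sum>i=0..n. a i * (\<Sum>j\<in>S. x j ^ (Suc n - i)))"
    by (intro sum.cong refl) (simp add: Suc_diff_le)
  ultimately show ?thesis by (simp add: a)
qed

text \<open>In terms of generating functions: if only the \<open>m\<close>-th power sums differ and \<open>k < 2 m\<close>, the
  quotient of the two products \<open>\<Prod>(1 - x\<^sub>i t)\<close> and \<open>\<Prod>(1 - y\<^sub>i t)\<close> is \<open>1 + h t\<^sup>m\<close> up to terms
  of degree above \<open>k\<close>.\<close>

lemma newton_missing_power_sum:
  fixes a b s t :: "nat \<Rightarrow> int"
  assumes a: "\<And>n. int (Suc n) * a (Suc n) = - (\<Sum>i=0..n. a i * s (Suc n - i))"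
    and b: "\<And>n. int (Suc n) * b (Suc n) = - (\<Sum>i=0..n. b i * t (Suc n - i))"
    and ab0: "a 0 = 1" "b 0 = 1"
    and st: "\<And>j. 1 \<le> j \<Longrightarrow> j \<le> k \<Longrightarrow> j \<noteq> m \<Longrightarrow> s j = t j"
    and m: "1 \<le> m" "k < 2 * m" and "n \<le> k"
  shows "a n - b n = (if n < m then 0 else (a m - b m) * b (n - m))"
  using \<open>n \<le> k\<close>
proof (induction n rule: less_induct)
  case (less n)
  have ab: "int (Suc n) * (a (Suc n) - b (Suc n)) =
      - (\<Sum>i=0..n. a i * s (Suc n - i) - b i * t (Suc n - i))" for n
    by (simp only: right_diff_distrib a b sum_subtractf)
  consider "n = 0" | "0 < n" "n < m" | "n = m" | "m < n" by linarith
  then show ?case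
  proof cases
    case 1
    then show ?thesis using ab0 m by simp
  next
    case 2
    then obtain n' where n': "n = Suc n'" by (cases n) auto
    have "(\<Sum>i=0..n'. a i * s (Suc n' - i) - b i * t (Suc n' - i)) = 0"
    proof (intro sum.neutral ballI)
      fix i assume "i \<in> {0..n'}"
      then have "a i - b i = 0" "s (Suc n' - i) = t (Suc n' - i)"
        using less.IH[of i] less.prems 2 n' by (auto intro!: st)
      then show "a i * s (Suc n' - i) - b i * t (Suc n' - i) = 0" by simp
    qed
    then have "int (Suc n') * (a (Suc n') - b (Suc n')) = 0"
      by (simp only: ab minus_zero)
    then have "a n - b n = 0" unfolding n' by (subst (asm) mult_eq_0_iff) auto
    then show ?thesis using 2 by simp
  next
    case 3
    then show ?thesis using ab0 by simp
  next
    case 4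
    define h where "h = a m - b m"
    define p where "p = n - m"
    have p: "1 \<le> p" "p < m" "n = p + m" "m \<le> k" using 4 m less.prems by (auto simp: p_def)
    obtain n' where n': "n = Suc n'" using 4 by (cases n) auto
    obtain m' where m': "m = Suc m'" using m by (cases m) auto
    obtain p' where p': "p = Suc p'" using p by (cases p) auto
    have eq: "a i = b i" if "i < m" for i
      using less.IH[of i] that 4 less.prems by auto
    \<comment> \<open>In the difference of the two Newton identities at index \<open>m\<close> only
      the term \<open>i = 0\<close> survives, because the earlier coefficients and the lower power
      sums agree.\<close>
    have sm: "s m - t m = - int m * h"
    proof -
      have "(\<Sum>i=0..m'. a i * s (Suc m' - i) - b i * t (Suc m' - i)) =
          (\<Sum>i=0..m'. if i = 0 then s m - t m else 0)"
      proof (intro sum.cong refl)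
        fix i assume "i \<in> {0..m'}"
        moreover from this have "i \<noteq> 0 \<Longrightarrow> s (Suc m' - i) = t (Suc m' - i)"
          using p m' by (intro st) auto
        ultimately show "a i * s (Suc m' - i) - b i * t (Suc m' - i) = (if i = 0 then s m - t m else 0)"
          using eq[of i] ab0 m' by auto
      qed
      then show ?thesis using ab[of m'] by (simp add: m' h_def algebra_simps)
    qed
    \<comment> \<open>Since \<open>n \<le> k < 2 * m\<close>, we have \<open>p < m\<close>, so the
      two sources of difference do not overlap: at \<open>i = p\<close> the power sums of index
      \<open>m\<close> differ, and for \<open>i \<ge> m\<close> the coefficients differ by
      \<open>h * b (i - m)\<close>, by induction.\<close>
    have "(\<Sum>i=0..n'. a i * s (Suc n' - i) - b i * t (Suc n' - i)) =
        (\<Sum>i=0..n'. (if i = p then b p * (s m - t m) else 0) +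
          (if i \<in> {m..n'} then h * b (i - m) * t (Suc n' - i) else 0))"
    proof (intro sum.cong refl)
      fix i assume i: "i \<in> {0..n'}"
      show "a i * s (Suc n' - i) - b i * t (Suc n' - i) =
        (if i = p then b p * (s m - t m) else 0) +
          (if i \<in> {m..n'} then h * b (i - m) * t (Suc n' - i) else 0)"
      proof (cases "i = p")
        case True
        moreover have "Suc n' - p = m" using p n' by simp
        ultimately show ?thesis using eq[of p] p by (simp add: algebra_simps)
      next
        case False
        have s: "s (Suc n' - i) = t (Suc n' - i)"
          using i False n' p less.prems by (intro st) auto
        show ?thesis
        proof (cases "i < m")
          case True
          then show ?thesis using eq[of i] s False by simp
        next
          case 2: False
          then have "a i = b i + h * b (i - m)"
            using less.IH[of i] i n' less.prems by (simp add: h_def)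
          then show ?thesis using s False 2 i by (simp add: algebra_simps)
        qed
      qed
    qed
    also have "\<dots> = b p * (s m - t m) + (\<Sum>i\<in>{m..n'}. h * b (i - m) * t (Suc n' - i))"
    proof -
      have "{0..n'} \<inter> {m..n'} = {m..n'}" by auto
      then have "(\<Sum>i=0..n'. if i \<in> {m..n'} then h * b (i - m) * t (Suc n' - i) else 0) =
          (\<Sum>i\<in>{m..n'}. h * b (i - m) * t (Suc n' - i))"
        by (metis (no_types) sum.inter_restrict finite_atLeastAtMost)
      moreover have "p \<in> {0..n'}" using p n' by auto
      ultimately show ?thesis
        by (simp only: sum.distrib sum.delta finite_atLeastAtMost if_True)
    qed
    \<comment> \<open>After the shift by \<open>m\<close> this is the Newton identity for
      \<open>b\<close> at index \<open>p\<close>. Together with the term from \<open>sm\<close> it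
      gives \<open>- n * h * b p\<close>, as \<open>n = p + m\<close>.\<close>
    also have "(\<Sum>i\<in>{m..n'}. h * b (i - m) * t (Suc n' - i)) =
        (\<Sum>i=0..p'. h * (b i * t (Suc p' - i)))"
      using p n' p' by (intro sum.reindex_bij_witness[of _ "\<lambda>i. i + m" "\<lambda>i. i - m"]) auto
    also have "\<dots> = - h * int p * b p"
      using b[of p'] by (simp add: p' mult.assoc flip: sum_distrib_left)
    finally have sum: "(\<Sum>i=0..n'. a i * s (Suc n' - i) - b i * t (Suc n' - i)) =
        b p * (s m - t m) + - h * int p * b p" .
    have "int n = int p + int m" using p(3) by simp
    then have "- (b p * (s m - t m) + - h * int p * b p) = int n * (h * b p)"
      by (simp only: sm) (simp add: algebra_simps)
    then have "int n * (a n - b n) = int n * (h * b p)"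
      using ab[of n'] by (simp only: sum n')
    then show ?thesis
      using 4 by (simp add: h_def p_def)
  qed
qed

text \<open>Coefficients are read from the top: index \<open>n\<close> of the recursion is the
  coefficient of \<open>z ^ (k - n)\<close>, with \<open>m = k - d\<close>, and
  \<open>k < 2 * m\<close> becomes \<open>2 * d < k\<close>. \<open>poly_shift (k - d)\<close> keeps
  exactly the top \<open>d + 1\<close> coefficients, which form the monic \<open>q\<close>.\<close>

lemma root_poly_diff:
  assumes S: "finite S" "card S = k" and d: "2 * d < k"
    and eq: "\<And>j. 1 \<le> j \<Longrightarrow> j \<le> k \<Longrightarrow> j \<noteq> k - d \<Longrightarrow> (\<Sum>i\<in>S. x i ^ j) = (\<Sum>i\<in>S. y i ^ j)"
  shows "\<exists>h. root_poly S x - root_poly S y = smult h (poly_shift (k - d) (root_poly S y))"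
proof -
  define m where "m = k - d"
  define a b where "a = coeff (reflect_poly (root_poly S x))"
    and "b = coeff (reflect_poly (root_poly S y))"
  have ab: "a n = coeff (root_poly S x) (k - n)" "b n = coeff (root_poly S y) (k - n)"
    if "n \<le> k" for n
    using that S by (auto simp: a_def b_def coeff_reflect_poly degree_root_poly)
  have main: "a n - b n = (if n < m then 0 else (a m - b m) * b (n - m))" if "n \<le> k" for n
    using newton_identity[OF S(1), where x = x, folded a_def]
      newton_identity[OF S(1), where x = y, folded b_def]
    by (rule newton_missing_power_sum[where k = k and m = m])
      (use that d eq lead_coeff_root_poly[of S x] lead_coeff_root_poly[of S y] S
        in \<open>auto simp: ab m_def\<close>)
  have "root_poly S x - root_poly S y = smult (a m - b m) (poly_shift m (root_poly S y))"
  proof (rule poly_eqI)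
    fix n
    show "coeff (root_poly S x - root_poly S y) n =
        coeff (smult (a m - b m) (poly_shift m (root_poly S y))) n"
    proof (cases "n \<le> k")
      case True
      show ?thesis
      proof (cases "n \<le> d")
        case True
        then have "k - (k - n - m) = n + m" using d by (auto simp: m_def)
        then show ?thesis using main[of "k - n"] True d
          by (auto simp: ab coeff_poly_shift m_def)
      next
        case False
        then have "coeff (root_poly S y) (n + m) = 0"
          using S by (intro coeff_eq_0) (auto simp: degree_root_poly m_def)
        then show ?thesis using main[of "k - n"] False True d
          by (auto simp: ab coeff_poly_shift m_def)
      qed
    next
      case False
      then show ?thesis using S
        by (auto simp: coeff_poly_shift coeff_eq_0 degree_root_poly)
    qed
  qed
  then show ?thesis unfolding m_def by blast
qed

text \<open>A product of linear factors determines its roots with multiplicity.\<close>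

lemma root_poly_eq_imp_permutes:
  assumes "finite S" "root_poly S x = root_poly S y"
  shows "\<exists>\<sigma>. \<sigma> permutes S \<and> (\<forall>i\<in>S. x i = y (\<sigma> i))"
proof -
  have *: "proots (root_poly S z) = image_mset z (mset_set S)" for z
  proof -
    have "(\<Sum>i\<in>S. {#z i#}) = image_mset z (mset_set S)"
      using assms(1) by (induction S rule: finite_induct) auto
    then show ?thesis by (simp add: root_poly_def proots_prod)
  qed
  have "image_mset x (mset_set S) = image_mset y (mset_set S)"
    using assms(2) by (simp flip: *)
  then show ?thesis
    using image_mset_eq_implies_permutes[OF assms(1)] by metis
qed

subsection \<open>Divisor bound and counting\<close>

text \<open>Each divisor of \<open>a * b\<close> splits as a divisor of \<open>a\<close> times a
  divisor of \<open>b\<close>, though not always uniquely.\<close>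

lemma card_divisors_mult_le:
  fixes a b :: nat
  assumes "a > 0" "b > 0"
  shows "card {e. e dvd a * b} \<le> card {e. e dvd a} * card {e. e dvd b}"
proof -
  have "{e. e dvd a * b} \<subseteq> (\<lambda>(u, v). u * v) ` ({e. e dvd a} \<times> {e. e dvd b})"
  proof
    fix e assume "e \<in> {e. e dvd a * b}"
    then obtain u v where "e = u * v" "u dvd a" "v dvd b"
      using division_decomp[of e a b] by auto
    then show "e \<in> (\<lambda>(u, v). u * v) ` ({e. e dvd a} \<times> {e. e dvd b})"
      by force
  qed
  moreover have "finite ({e. e dvd a} \<times> {e. e dvd b})"
    using assms by simp
  ultimately have "card {e. e dvd a * b} \<le> card ({e. e dvd a} \<times> {e. e dvd b})"
    by (meson card_image_le card_mono finite_imageI le_trans)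
  then show ?thesis by (simp add: card_cartesian_product)
qed

lemma card_divisors_prime_power:
  fixes p :: nat
  assumes "prime p"
  shows "card {e. e dvd p ^ a} \<le> Suc a"
proof -
  have "{e. e dvd p ^ a} \<subseteq> (\<lambda>i. p ^ i) ` {..a}"
    using divides_primepow_nat[OF assms] by auto
  then have "card {e. e dvd p ^ a} \<le> card {..a}"
    by (meson card_image_le card_mono finite_imageI finite_atMost le_trans)
  then show ?thesis by simp
qed

text \<open>Primes \<open>p \<ge> 2 powr (1 / \<delta>)\<close> cost nothing because \<open>a + 1 \<le> 2 ^ a \<le> p powr (\<delta> a)\<close>;
  each of the finitely many smaller ones costs a constant factor.\<close>

lemma divisor_bound:
  fixes \<delta> :: real
  assumes "\<delta> > 0"
  shows "\<exists>C\<ge>1. \<forall>n::nat. n > 0 \<longrightarrow> real (card {e. e dvd n}) \<le> C * real n powr \<delta>"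
proof -
  define T where "T = nat \<lceil>2 powr (1 / \<delta>)\<rceil>"
  \<comment> \<open>Chosen so that \<open>1 + a \<le> c * (1 + \<delta> * ln 2 * a)\<close>, where
    the second factor is at most \<open>2 powr (\<delta> * a)\<close>.\<close>
  define c where "c = 1 + 1 / (\<delta> * ln 2)"
  have c1: "c \<ge> 1" using assms by (simp add: c_def)
  have large: "real (Suc a) \<le> real (p ^ a) powr \<delta>" if "p \<ge> T" "prime p" for p a
  proof -
    have p: "real p \<ge> 2 powr (1 / \<delta>)" using that(1) unfolding T_def by linarith
    have "Suc a \<le> 2 ^ a" by (induction a) auto
    then have "real (Suc a) \<le> 2 ^ a" by (metis of_nat_le_iff of_nat_numeral of_nat_power)
    also have "\<dots> = ((2 powr (1 / \<delta>)) powr \<delta>) ^ a"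
      using assms by (simp add: powr_powr)
    also have "\<dots> \<le> (real p powr \<delta>) ^ a"
      using assms p by (intro power_mono powr_mono2) auto
    also have "\<dots> = real (p ^ a) powr \<delta>"
      using prime_gt_0_nat[OF that(2)] by (simp add: powr_powr mult.commute flip: powr_realpow)
    finally show ?thesis .
  qed
  have small: "real (Suc a) \<le> c * real (p ^ a) powr \<delta>" if "prime p" for p a
  proof -
    have p: "real p \<ge> 2" using prime_ge_2_nat[OF that] by simp
    have "1 + \<delta> * ln 2 * a \<le> exp (\<delta> * ln 2 * a)"
      by (rule exp_ge_add_one_self)
    also have "\<dots> = (2 ^ a) powr \<delta>"
      by (simp add: powr_def ln_realpow algebra_simps)
    also have "\<dots> \<le> real (p ^ a) powr \<delta>"
      using assms p by (intro powr_mono2) (auto intro: power_mono)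
    finally have *: "1 + \<delta> * ln 2 * a \<le> real (p ^ a) powr \<delta>" .
    have "real (Suc a) \<le> c * (1 + \<delta> * ln 2 * a)"
    proof -
      have "\<delta> * ln 2 > 0" using assms by simp
      moreover have "1 + a \<le> (1 + 1 / z) * (1 + z * a)" if "z > 0" for z :: real
        using that by (simp add: field_simps)
      ultimately show ?thesis unfolding c_def by simp
    qed
    also have "\<dots> \<le> c * real (p ^ a) powr \<delta>"
      using * c1 by (intro mult_left_mono) auto
    finally show ?thesis .
  qed
  \<comment> \<open>The exponent of \<open>c\<close> counts only the small primes dividing
    \<open>n\<close>, so stripping the full power of one prime \<open>p\<close> costs a factor
    \<open>c\<close> if \<open>p < T\<close> and nothing otherwise.\<close>
  have main: "real (card {e. e dvd n}) \<le> c ^ card (prime_factors n \<inter> {..<T}) * real n powr \<delta>"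
    if "n > 0" for n :: nat
    using that
  proof (induction n rule: less_induct)
    case (less n)
    show ?case
    proof (cases "n = 1")
      case True
      then show ?thesis by simp
    next
      case False
      then obtain p where p: "prime p" "p dvd n" using prime_factor_nat by blast
      define a where "a = multiplicity p n"
      obtain m where m: "n = p ^ a * m" "\<not> p dvd m"
        using multiplicity_decompose'[of n p] p less.prems unfolding a_def
        by (metis not_prime_unit less_numeral_extra(3))
      have "m > 0" using m less.prems by (cases m) auto
      have "a > 0" using p less.prems
        by (simp add: a_def prime_multiplicity_gt_zero_iff)
      have "m < n"
      proof -
        have "p ^ a > 1" using \<open>a > 0\<close> prime_gt_1_nat[OF p(1)] by (rule one_less_power[rotated])
        then show ?thesis using \<open>m > 0\<close> m(1) by simp
      qed
      have pf: "prime_factors n = insert p (prime_factors m)"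
        using p(1) prime_gt_0_nat[OF p(1)] \<open>m > 0\<close> \<open>a > 0\<close> unfolding m(1)
        by (subst prime_factors_product) (simp_all add: prime_factorization_prime_power)
      have pm: "p \<notin> prime_factors m" using m(2) by auto
      define f where "f = c ^ card (prime_factors m \<inter> {..<T})"
      have f: "f \<ge> 0" using c1 by (simp add: f_def)
      have "card {e. e dvd n} \<le> Suc a * card {e. e dvd m}"
        using card_divisors_mult_le[of "p ^ a" m] card_divisors_prime_power[OF p(1), of a]
          \<open>m > 0\<close> p m(1) by (metis le_trans mult_le_mono1 prime_gt_0_nat zero_less_power)
      then have "real (card {e. e dvd n}) \<le> real (Suc a) * real (card {e. e dvd m})"
        by (metis of_nat_le_iff of_nat_mult)
      also have "\<dots> \<le> real (Suc a) * (f * real m powr \<delta>)"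
        using less.IH[OF \<open>m < n\<close> \<open>m > 0\<close>] by (intro mult_left_mono) (auto simp: f_def)
      also have "\<dots> \<le> c ^ card (prime_factors n \<inter> {..<T}) * real n powr \<delta>"
      proof (cases "p < T")
        case True
        then have "c ^ card (prime_factors n \<inter> {..<T}) = c * f"
          using pm by (simp add: pf f_def)
        moreover have "real (Suc a) * (f * real m powr \<delta>) \<le>
            (c * real (p ^ a) powr \<delta>) * (f * real m powr \<delta>)"
          using small[OF p(1)] f by (intro mult_right_mono) auto
        ultimately show ?thesis by (simp add: m(1) powr_mult algebra_simps)
      next
        case False
        then have "c ^ card (prime_factors n \<inter> {..<T}) = f"
          by (simp add: pf f_def)
        moreover have "real (Suc a) * (f * real m powr \<delta>) \<le>
            real (p ^ a) powr \<delta> * (f * real m powr \<delta>)"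
          using large[of p a] False p f by (intro mult_right_mono) auto
        ultimately show ?thesis by (simp add: m(1) powr_mult algebra_simps)
      qed
      finally show ?thesis .
    qed
  qed
  have "real (card {e. e dvd n}) \<le> c ^ T * real n powr \<delta>" if "n > 0" for n :: nat
  proof -
    have "card (prime_factors n \<inter> {..<T}) \<le> card {..<T}"
      by (intro card_mono) auto
    then have "c ^ card (prime_factors n \<inter> {..<T}) \<le> c ^ T"
      using c1 by (intro power_increasing) auto
    then show ?thesis
      using main[OF that] by (meson mult_right_mono order_trans powr_ge_zero)
  qed
  moreover have "c ^ T \<ge> 1" using c1 by (rule one_le_power)
  ultimately show ?thesis by blast
qed

lemma card_int_divisors:
  fixes N :: int
  assumes "N \<noteq> 0"
  shows "finite {e. e dvd N}" "card {e. e dvd N} \<le> 2 * card {e. e dvd nat \<bar>N\<bar>}"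
proof -
  let ?D = "{e. e dvd nat \<bar>N\<bar>}"
  have D: "finite ?D" using assms by (intro finite_divisors_nat) simp
  have sub: "{e. e dvd N} \<subseteq> int ` ?D \<union> (\<lambda>e. - int e) ` ?D"
  proof
    fix e assume "e \<in> {e. e dvd N}"
    then have "nat \<bar>e\<bar> \<in> ?D" by (simp add: nat_abs_dvd_iff)
    moreover have "e = int (nat \<bar>e\<bar>) \<or> e = - int (nat \<bar>e\<bar>)" by auto
    ultimately show "e \<in> int ` ?D \<union> (\<lambda>e. - int e) ` ?D" by blast
  qed
  show "finite {e. e dvd N}" using D by (intro finite_subset[OF sub]) auto
  have "card {e. e dvd N} \<le> card (int ` ?D \<union> (\<lambda>e. - int e) ` ?D)"
    using D by (intro card_mono[OF _ sub]) auto
  also have "\<dots> \<le> card (int ` ?D) + card ((\<lambda>e. - int e) ` ?D)"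
    by (rule card_Un_le)
  also have "\<dots> \<le> card ?D + card ?D"
    by (intro add_mono card_image_le D)
  finally show "card {e. e dvd N} \<le> 2 * card ?D" by simp
qed

section \<open>Counting tuples coordinate by coordinate\<close>

text \<open>Prefixes are counted by induction on their length: a prefix of length
  \<open>m + 1\<close> is one of length \<open>m\<close> together with one of at most
  \<open>M\<close> admissible next entries. The \<open>restrict\<close> makes the admissible set
  depend on the earlier coordinates only.\<close>

lemma card_sequential_le:
  fixes F :: "(nat \<Rightarrow> 'a) set"
  assumes ext: "\<And>x. x \<in> F \<Longrightarrow> x \<in> extensional {1..k}"
    and step: "\<And>x s. x \<in> F \<Longrightarrow> s \<in> {1..k} \<Longrightarrow> x s \<in> A s (restrict x {1..<s})"
    and fin: "\<And>x s. x \<in> F \<Longrightarrow> s \<in> {1..k} \<Longrightarrow> finite (A s (restrict x {1..<s}))"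
    and card: "\<And>x s. x \<in> F \<Longrightarrow> s \<in> {1..k} \<Longrightarrow> card (A s (restrict x {1..<s})) \<le> M"
  shows "finite F \<and> card F \<le> M ^ k"
proof -
  define G where "G m = (\<lambda>x. restrict x {1..m}) ` F" for m
  have "finite (G m) \<and> card (G m) \<le> M ^ m" if "m \<le> k" for m
    using that
  proof (induction m)
    case 0
    have "G 0 \<subseteq> {\<lambda>_. undefined}" by (auto simp: G_def restrict_def)
    then show ?case by (auto simp: subset_singleton_iff)
  next
    case (Suc m)
    then have IH: "finite (G m)" "card (G m) \<le> M ^ m" by auto
    have less: "{Suc 0..<Suc m} = {Suc 0..m}" by auto
    define \<Phi> where "\<Phi> g = (restrict g {1..m}, g (Suc m))" for g :: "nat \<Rightarrow> 'a"
    have B: "finite (A (Suc m) g)" "card (A (Suc m) g) \<le> M" if "g \<in> G m" for g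
      using that fin[of _ "Suc m"] card[of _ "Suc m"] Suc.prems by (auto simp: G_def less)
    have "inj_on \<Phi> (G (Suc m))"
    proof (rule inj_onI)
      fix g g' assume g: "g \<in> G (Suc m)" "g' \<in> G (Suc m)" "\<Phi> g = \<Phi> g'"
      show "g = g'"
      proof
        fix i
        consider "i \<in> {1..m}" | "i = Suc m" | "i \<notin> {1..Suc m}" by fastforce
        then show "g i = g' i"
        proof cases
          case 1
          then show ?thesis using g(3) unfolding \<Phi>_def by (metis prod.inject restrict_apply')
        next
          case 2
          then show ?thesis using g(3) by (simp add: \<Phi>_def)
        next
          case 3
          then show ?thesis using g(1,2) by (auto simp: G_def)
        qed
      qed
    qed
    moreover have "\<Phi> ` G (Suc m) \<subseteq> Sigma (G m) (A (Suc m))"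
    proof -
      have "\<Phi> (restrict x {1..Suc m}) \<in> Sigma (G m) (A (Suc m))" if "x \<in> F" for x
      proof -
        have "restrict (restrict x {1..Suc m}) {1..m} = restrict x {1..m}"
          by (auto simp: restrict_def)
        then show ?thesis
          using that step[OF that, of "Suc m"] Suc.prems by (auto simp: \<Phi>_def G_def less)
      qed
      then show ?thesis unfolding G_def by blast
    qed
    moreover have fin': "finite (Sigma (G m) (A (Suc m)))"
      using IH B by auto
    ultimately have "finite (G (Suc m))" "card (G (Suc m)) \<le> card (Sigma (G m) (A (Suc m)))"
      by (meson inj_on_finite, meson card_inj_on_le)
    moreover have "card (Sigma (G m) (A (Suc m))) = (\<Sum>g\<in>G m. card (A (Suc m) g))"
      using IH B by (intro card_SigmaI) auto
    moreover have "\<dots> \<le> (\<Sum>g\<in>G m. M)" using B by (intro sum_mono) auto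
    moreover have "(\<Sum>g\<in>G m. M) \<le> M ^ m * M"
      using mult_le_mono1[OF IH(2), of M] by (simp only: sum_constant of_nat_id)
    ultimately show ?case unfolding power_Suc2 by linarith
  qed
  moreover have "G k = F"
    using ext by (force simp: G_def extensional_restrict)
  ultimately show ?thesis by blast
qed

section \<open>Assigning prime factors to the factors of a product\<close>

text \<open>A prime dividing a product divides one of its factors. Cancelling it there leaves the
  same problem with one prime fewer and a changed factor, hence the induction for arbitrary
  \<open>u\<close>.\<close>

lemma prime_coloring:
  fixes u :: "'b \<Rightarrow> int" and p :: "'e \<Rightarrow> int"
  assumes "finite E" "\<And>e. e \<in> E \<Longrightarrow> prime (p e)" "finite K" "(\<Prod>e\<in>E. p e) dvd (\<Prod>i\<in>K. u i)"
  shows "\<exists>c. c ` E \<subseteq> K \<and> (\<forall>i\<in>K. (\<Prod>e\<in>{e\<in>E. c e = i}. p e) dvd u i)"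
  using assms(1,2,4)
proof (induction E arbitrary: u rule: finite_induct)
  case empty
  then show ?case by auto
next
  case (insert e E)
  have pe: "prime (p e)" using insert.prems by auto
  have "p e dvd (\<Prod>i\<in>K. u i)"
    using insert.prems(2) insert.hyps by (auto dest: dvd_mult_left)
  then obtain i v where i: "i \<in> K" "u i = p e * v"
    using pe \<open>finite K\<close> by (auto simp: prime_dvd_prod_iff elim: dvdE)
  define u' where "u' = u(i := v)"
  have "(\<Prod>i\<in>K. u i) = u i * (\<Prod>i\<in>K - {i}. u i)"
    using i \<open>finite K\<close> by (simp add: prod.remove)
  also have "(\<Prod>i\<in>K - {i}. u i) = (\<Prod>i\<in>K - {i}. u' i)"
    by (intro prod.cong) (auto simp: u'_def)
  also have "u i * \<dots> = p e * (u' i * (\<Prod>i\<in>K - {i}. u' i))"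
    by (simp add: i u'_def)
  also have "u' i * (\<Prod>i\<in>K - {i}. u' i) = (\<Prod>i\<in>K. u' i)"
    using i \<open>finite K\<close> by (simp add: prod.remove)
  finally have "(\<Prod>e\<in>E. p e) dvd (\<Prod>i\<in>K. u' i)"
    using insert.prems(2) insert.hyps pe by auto
  then obtain c where c: "c ` E \<subseteq> K" "\<And>i. i \<in> K \<Longrightarrow> (\<Prod>e\<in>{e\<in>E. c e = i}. p e) dvd u' i"
    using insert.IH[of u'] insert.prems(1) by auto
  define c' where "c' = c(e := i)"
  have "(\<Prod>e\<in>{a\<in>insert e E. c' a = j}. p e) dvd u j" if "j \<in> K" for j
  proof (cases "j = i")
    case True
    then have "{a\<in>insert e E. c' a = j} = insert e {a\<in>E. c a = i}"
      using insert.hyps by (auto simp: c'_def)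
    then show ?thesis
      using c(2)[OF i(1)] insert.hyps True i by (simp add: u'_def mult_dvd_mono)
  next
    case False
    then have "{a\<in>insert e E. c' a = j} = {a\<in>E. c a = j}"
      using insert.hyps by (auto simp: c'_def)
    then show ?thesis
      using c(2)[OF that] False by (simp add: u'_def)
  qed
  moreover have "c' ` insert e E \<subseteq> K"
    using c(1) i insert.hyps by (auto simp: c'_def)
  ultimately show ?case by blast
qed

text \<open>Indices stand for prime factors with multiplicity, so that equal primes can receive
  different colours.\<close>

lemma prime_factorization_indexed:
  fixes h :: int
  assumes "h \<noteq> 0"
  shows "\<exists>(E :: nat set) p. finite E \<and> (\<forall>e\<in>E. prime (p e)) \<and> (\<Prod>e\<in>E. p e) = \<bar>h\<bar>"
proof -
  obtain xs where xs: "mset xs = prime_factorization h"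
    by (metis ex_mset)
  have "prod_list xs = \<bar>h\<bar>"
    using assms by (simp add: xs prod_mset_prime_factorization flip: prod_mset_prod_list)
  then have "(\<Prod>e<length xs. xs ! e) = \<bar>h\<bar>"
    by (simp add: prod.list_conv_set_nth atLeast0LessThan)
  moreover have "prime (xs ! e)" if "e < length xs" for e
    using that xs by (metis nth_mem set_mset_mset in_prime_factors_imp_prime)
  ultimately show ?thesis
    by (intro exI[of _ "{..<length xs}"] exI[of _ "\<lambda>e. xs ! e"]) auto
qed

subsection \<open>Distribution of prime factors\<close>

text \<open>The cofactor is the product over the intersection. Covers by overlapping sets can thus
  be handled by divisibility.\<close>

lemma prod_Un_dvd:
  fixes p :: "'a \<Rightarrow> 'b :: comm_semiring_1"
  assumes "finite A" "finite B"
  shows "prod p (A \<union> B) dvd prod p A * prod p B"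
  using prod.union_inter[OF assms, of p] by (metis dvd_triv_left)

lemma prod_UN_dvd:
  fixes p :: "'a \<Rightarrow> 'b :: comm_semiring_1"
  assumes "finite I" "\<And>i. i \<in> I \<Longrightarrow> finite (A i)"
  shows "prod p (\<Union>i\<in>I. A i) dvd (\<Prod>i\<in>I. prod p (A i))"
  using assms
proof (induction I rule: finite_induct)
  case (insert i I)
  have "prod p (A i \<union> (\<Union>i\<in>I. A i)) dvd prod p (A i) * prod p (\<Union>i\<in>I. A i)"
    using insert by (intro prod_Un_dvd) auto
  also have "\<dots> dvd prod p (A i) * (\<Prod>i\<in>I. prod p (A i))"
    using insert by (intro mult_dvd_mono) auto
  finally show ?case using insert.hyps by simp
qed simp

text \<open>Colour each prime factor \<open>e\<close> of \<open>h\<close>, for every \<open>z \<in> Z\<close>, with an index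
  \<open>c z e\<close> such that \<open>e\<close> is absorbed by the factor \<open>z - x (c z e)\<close>. Factors with \<open>c a e = c b e\<close>
  divide \<open>a - b\<close>. For the other factors the smallest colour is attained at a unique \<open>z\<close>,
  and \<open>z0\<close> is the point for which the product \<open>B\<close> of those attaining it at \<open>z0\<close> is smallest.\<close>

lemma exists_recursive_divisibility:
  fixes x :: "nat \<Rightarrow> int" and q :: "int \<Rightarrow> int" and h :: int
  assumes h: "h \<noteq> 0" and Z: "finite Z" "Z \<noteq> {}"
    and eq: "\<And>z. z \<in> Z \<Longrightarrow> (\<Prod>i\<in>{1..k}. z - x i) = h * q z"
  shows "\<exists>z0\<in>Z. \<exists>B>0. B ^ card Z \<le> \<bar>h\<bar> \<and> (\<forall>s\<in>{1..k}. z0 - x s dvd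
    (\<Prod>(a, b)\<in>{(a, b). a \<in> Z \<and> b \<in> Z \<and> a \<noteq> b}. a - b) ^ k * B * q z0 *
      (\<Prod>t\<in>{1..<s}. \<Prod>z\<in>Z. z - x t))"
proof -
  obtain E :: "nat set" and p where E: "finite E" "\<And>e. e \<in> E \<Longrightarrow> prime (p e)" "prod p E = \<bar>h\<bar>"
    using prime_factorization_indexed[OF h] by blast
  have p0: "p e > 0" if "e \<in> E" for e using E(2)[OF that] by (rule prime_gt_0_int)
  have pos: "prod p A > 0" if "A \<subseteq> E" for A
    using that p0 by (intro prod_pos) auto
  have "\<exists>c. c ` E \<subseteq> {1..k} \<and> (\<forall>i\<in>{1..k}. prod p {e\<in>E. c e = i} dvd z - x i)" if "z \<in> Z" for z
    using E eq[OF that] by (intro prime_coloring) auto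
  then obtain c where c: "\<And>z. z \<in> Z \<Longrightarrow> c z ` E \<subseteq> {1..k}"
    "\<And>z i. z \<in> Z \<Longrightarrow> i \<in> {1..k} \<Longrightarrow> prod p {e\<in>E. c z e = i} dvd z - x i"
    by metis
  define P where "P = {(a, b). a \<in> Z \<and> b \<in> Z \<and> a \<noteq> b}"
  have finP: "finite P"
    by (rule finite_subset[of _ "Z \<times> Z"]) (use Z in \<open>auto simp: P_def\<close>)
  \<comment> \<open>\<open>Q z\<close> collects the prime factors whose colour at \<open>z\<close>
    is strictly smaller than at every other point. These sets are disjoint, so the product of all
    \<open>B z\<close> divides \<open>h\<close>, and the smallest \<open>B z\<close> has its
    \<open>card Z\<close>-th power bounded by the absolute value of \<open>h\<close>.\<close>
  define Q where "Q z = {e\<in>E. \<forall>z'\<in>Z. z' \<noteq> z \<longrightarrow> c z e < c z' e}" for z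
  have QE: "Q z \<subseteq> E" for z by (auto simp: Q_def)
  define B where "B z = prod p (Q z)" for z
  have "(\<Prod>z\<in>Z. B z) = prod p (\<Union>z\<in>Z. Q z)"
    unfolding B_def
  proof (rule prod.UNION_disjoint[symmetric])
    show "\<forall>z\<in>Z. \<forall>z'\<in>Z. z \<noteq> z' \<longrightarrow> Q z \<inter> Q z' = {}"
      by (fastforce simp: Q_def)
  qed (use Z finite_subset[OF QE E(1)] in auto)
  also have "\<dots> dvd prod p E"
    using E QE by (intro prod_dvd_prod_subset) auto
  finally have Ble: "(\<Prod>z\<in>Z. B z) \<le> \<bar>h\<bar>"
    using h unfolding E(3) by (intro zdvd_imp_le) auto
  obtain z0 where z0: "z0 \<in> Z" "\<And>z. z \<in> Z \<Longrightarrow> B z0 \<le> B z"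
    using Z ex_is_arg_min_if_finite[of Z B] by (auto simp: is_arg_min_linorder)
  have B0: "B z0 > 0" using pos[OF QE] by (simp add: B_def)
  have "B z0 ^ card Z = (\<Prod>z\<in>Z. B z0)" by simp
  also have "\<dots> \<le> (\<Prod>z\<in>Z. B z)"
    using z0 B0 by (intro prod_mono) auto
  finally have B1: "B z0 ^ card Z \<le> \<bar>h\<bar>" using Ble by simp
  define w where "w s = (z0 - x s) div prod p {e\<in>E. c z0 e = s}" for s
  have w: "z0 - x s = prod p {e\<in>E. c z0 e = s} * w s" if "s \<in> {1..k}" for s
    using c(2)[OF z0(1) that] by (simp add: w_def)
  \<comment> \<open>The colours at \<open>z0\<close> distribute all of \<open>h\<close> over the
    factors \<open>z0 - x i\<close>. Cancelling \<open>h\<close> in the equation at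
    \<open>z0\<close> shows that the product of the cofactors \<open>w i\<close> divides
    \<open>q z0\<close>.\<close>
  have wq: "w s dvd q z0" if "s \<in> {1..k}" for s
  proof -
    have "h * q z0 = (\<Prod>i\<in>{1..k}. prod p {e\<in>E. c z0 e = i}) * (\<Prod>i\<in>{1..k}. w i)"
      unfolding eq[OF z0(1), symmetric] prod.distrib[symmetric] by (intro prod.cong refl w)
    also have "(\<Prod>i\<in>{1..k}. prod p {e\<in>E. c z0 e = i}) = \<bar>h\<bar>"
      using E c(1)[OF z0(1)] by (subst prod.group) auto
    finally have "h * (\<Prod>i\<in>{1..k}. w i) dvd h * q z0"
      by simp
    then have "(\<Prod>i\<in>{1..k}. w i) dvd q z0" using h by simp
    moreover have "w s dvd (\<Prod>i\<in>{1..k}. w i)" using that by (intro dvd_prodI) auto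
    ultimately show ?thesis by (rule dvd_trans[rotated])
  qed
  have "z0 - x s dvd (\<Prod>(a, b)\<in>P. a - b) ^ k * B z0 * q z0 * (\<Prod>t\<in>{1..<s}. \<Prod>z\<in>Z. z - x t)"
    if s: "s \<in> {1..k}" for s
  proof -
    define E1 where "E1 = (\<Union>(ab, i)\<in>P \<times> {1..k}. {e\<in>E. c (fst ab) e = i \<and> c (snd ab) e = i})"
    define E2 where "E2 = (\<Union>(t, z)\<in>{1..<s} \<times> Z. {e\<in>E. c z e = t})"
    have fin: "finite E1" "finite E2" "finite (Q z0)"
      using E finP Z QE[of z0] by (auto simp: E1_def E2_def intro: finite_subset)
    \<comment> \<open>A factor of colour \<open>s\<close> at \<open>z0\<close> outside
      \<open>Q z0\<close> has colour at most \<open>s\<close> at some other \<open>z\<close>.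
      Equality puts it into \<open>E1\<close>; a smaller colour \<open>t\<close> puts it into
      \<open>E2\<close>, where it is absorbed by \<open>z - x t\<close> with
      \<open>t < s\<close>.\<close>
    have "{e\<in>E. c z0 e = s} \<subseteq> E1 \<union> Q z0 \<union> E2"
    proof
      fix e assume e: "e \<in> {e\<in>E. c z0 e = s}"
      show "e \<in> E1 \<union> Q z0 \<union> E2"
      proof (cases "e \<in> Q z0")
        case False
        then obtain z where z: "z \<in> Z" "z \<noteq> z0" "c z e \<le> s"
          using e by (auto simp: Q_def not_less)
        have "c z e \<in> {1..k}" using c(1)[OF z(1)] e by auto
        show ?thesis
        proof (cases "c z e = s")
          case True
          then have "((z, z0), s) \<in> P \<times> {1..k}" "e \<in> {e\<in>E. c z e = s \<and> c z0 e = s}"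
            using z z0 e s by (auto simp: P_def)
          then show ?thesis unfolding E1_def by force
        next
          case False
          then have "(c z e, z) \<in> {1..<s} \<times> Z"
            using z \<open>c z e \<in> {1..k}\<close> by auto
          then show ?thesis using e unfolding E2_def by force
        qed
      qed simp
    qed
    then have "prod p {e\<in>E. c z0 e = s} dvd prod p (E1 \<union> Q z0 \<union> E2)"
      using fin by (intro prod_dvd_prod_subset) auto
    also have "\<dots> dvd prod p (E1 \<union> Q z0) * prod p E2"
      using fin by (intro prod_Un_dvd) auto
    also have "\<dots> dvd prod p E1 * B z0 * prod p E2"
      unfolding B_def using fin by (intro mult_dvd_mono prod_Un_dvd) auto
    finally have 1: "prod p {e\<in>E. c z0 e = s} dvd prod p E1 * B z0 * prod p E2" .
    \<comment> \<open>Each of the \<open>k\<close> colours can contribute its own factor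
      \<open>a - b\<close>, which produces the \<open>k\<close>-th power.\<close>
    have "prod p E1 dvd (\<Prod>(ab, i)\<in>P \<times> {1..k}. prod p {e\<in>E. c (fst ab) e = i \<and> c (snd ab) e = i})"
      unfolding E1_def using prod_UN_dvd[of "P \<times> {1..k}"
        "\<lambda>(ab, i). {e\<in>E. c (fst ab) e = i \<and> c (snd ab) e = i}" p] finP E
      by (simp add: case_prod_unfold)
    also have "\<dots> dvd (\<Prod>(ab, i)\<in>P \<times> {1..k}. fst ab - snd ab)"
    proof (rule prod_dvd_prod, clarify)
      fix a b i assume ab: "(a, b) \<in> P" and i: "i \<in> {1..k}"
      let ?A = "{e\<in>E. c (fst (a, b)) e = i \<and> c (snd (a, b)) e = i}"
      have "prod p ?A dvd prod p {e\<in>E. c z e = i}" if "z = a \<or> z = b" for z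
        using E that by (intro prod_dvd_prod_subset) auto
      then have "prod p ?A dvd a - x i" "prod p ?A dvd b - x i"
        using c(2)[OF _ i] ab by (auto simp: P_def intro: dvd_trans)
      then have "prod p ?A dvd (a - x i) - (b - x i)" by (rule dvd_diff)
      then show "prod p ?A dvd fst (a, b) - snd (a, b)" by simp
    qed
    also have "(\<Prod>(ab, i)\<in>P \<times> {1..k}. fst ab - snd ab) = (\<Prod>(a, b)\<in>P. a - b) ^ k"
      unfolding prod.cartesian_product[symmetric]
      by (simp add: prod_power_distrib case_prod_unfold)
    finally have 2: "prod p E1 dvd (\<Prod>(a, b)\<in>P. a - b) ^ k" .
    have "prod p E2 dvd (\<Prod>(t, z)\<in>{1..<s} \<times> Z. prod p {e\<in>E. c z e = t})"
      unfolding E2_def using prod_UN_dvd[of "{1..<s} \<times> Z" "\<lambda>(t, z). {e\<in>E. c z e = t}" p] Z E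
      by (simp add: case_prod_unfold)
    also have "\<dots> dvd (\<Prod>(t, z)\<in>{1..<s} \<times> Z. z - x t)"
      using c(2) s by (intro prod_dvd_prod) auto
    also have "\<dots> = (\<Prod>t\<in>{1..<s}. \<Prod>z\<in>Z. z - x t)"
      by (simp add: prod.cartesian_product)
    finally have 3: "prod p E2 dvd (\<Prod>t\<in>{1..<s}. \<Prod>z\<in>Z. z - x t)" .
    have "z0 - x s dvd (prod p E1 * B z0 * prod p E2) * q z0"
      unfolding w[OF s] using 1 wq[OF s] by (rule mult_dvd_mono)
    also have "\<dots> dvd ((\<Prod>(a, b)\<in>P. a - b) ^ k * B z0 * (\<Prod>t\<in>{1..<s}. \<Prod>z\<in>Z. z - x t)) * q z0"
      using 2 3 by (intro mult_dvd_mono) auto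
    finally show ?thesis by (simp add: mult_ac)
  qed
  then show ?thesis
    using z0(1) B0 B1 unfolding P_def by blast
qed

subsection \<open>Non-diagonal solutions\<close>

lemma abs_prod_le_power:
  fixes f :: "'a \<Rightarrow> int"
  assumes "\<And>i. i \<in> A \<Longrightarrow> \<bar>f i\<bar> \<le> N" "1 \<le> N" "card A \<le> m"
  shows "\<bar>\<Prod>i\<in>A. f i\<bar> \<le> N ^ m"
proof -
  have "\<bar>\<Prod>i\<in>A. f i\<bar> \<le> (\<Prod>i\<in>A. N)"
    unfolding abs_prod using assms by (intro prod_mono) auto
  also have "\<dots> \<le> N ^ m"
    using assms by (simp add: power_increasing)
  finally show ?thesis .
qed

section \<open>Size of coefficients and elementary counts\<close>

text \<open>The coefficient of \<open>z ^ i\<close> is an elementary symmetric function of degree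
  \<open>card S - i\<close> in the \<open>x_j\<close>. Weighting it by \<open>N ^ i\<close> avoids
  subtraction in exponents; each further linear factor multiplies the bound by
  \<open>2 * N\<close>.\<close>

lemma coeff_root_poly_bound:
  fixes N :: int
  assumes "finite S" "\<And>i. i \<in> S \<Longrightarrow> \<bar>x i\<bar> \<le> N" "N \<ge> 1"
  shows "\<bar>coeff (root_poly S x) i\<bar> * N ^ i \<le> 2 ^ card S * N ^ card S"
  using assms(1,2)
proof (induction S arbitrary: i rule: finite_induct)
  case empty
  then show ?case using assms(3) by (cases i) (auto simp: root_poly_def)
next
  case (insert j S)
  let ?c = "\<lambda>i. \<bar>coeff (root_poly S x) i\<bar>" and ?b = "2 ^ card S * N ^ card S"
  have IH: "?c i * N ^ i \<le> ?b" for i using insert by auto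
  have b: "0 \<le> ?b" using assms(3) by simp
  have R: "root_poly (insert j S) x = pCons 0 (root_poly S x) - smult (x j) (root_poly S x)"
    using insert.hyps by (simp add: root_poly_def)
  have x: "\<bar>x j\<bar> * (?c i * N ^ i) \<le> N * ?b" for i
    by (rule mult_mono[OF _ IH[of i]]) (use insert.prems[of j] assms(3) in auto)
  show ?case
  proof (cases i)
    case 0
    then have "\<bar>coeff (root_poly (insert j S) x) i\<bar> * N ^ i = \<bar>x j\<bar> * (?c 0 * N ^ 0)"
      by (simp add: R abs_mult)
    also have "\<dots> \<le> 2 * (N * ?b)"
      using x[of 0] mult_nonneg_nonneg[OF _ b, of N] assms(3) by linarith
    finally show ?thesis using insert.hyps by (simp add: algebra_simps)
  next
    case (Suc i')
    have "\<bar>coeff (root_poly (insert j S) x) i\<bar> \<le> ?c i' + \<bar>x j\<bar> * ?c i"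
      unfolding R Suc abs_mult[symmetric] by simp
    then have "\<bar>coeff (root_poly (insert j S) x) i\<bar> * N ^ i \<le> (?c i' + \<bar>x j\<bar> * ?c i) * N ^ i"
      using assms(3) by (intro mult_right_mono) auto
    also have "\<dots> = N * (?c i' * N ^ i') + \<bar>x j\<bar> * (?c i * N ^ i)"
      by (simp add: Suc algebra_simps)
    also have "\<dots> \<le> N * ?b + N * ?b"
      using IH[of i'] x[of i] assms(3) by (intro add_mono mult_left_mono) auto
    finally show ?thesis using insert.hyps by (simp add: algebra_simps)
  qed
qed

lemma degree_shift_root_poly:
  assumes "card S = k" "d \<le> k"
  shows "degree (poly_shift (k - d) (root_poly S x)) \<le> d"
  using assms by (intro degree_le) (auto simp: coeff_poly_shift coeff_eq_0 degree_root_poly)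

lemma shift_root_poly_nonzero:
  assumes "card S = k" "d \<le> k"
  shows "poly_shift (k - d) (root_poly S x) \<noteq> 0"
proof -
  have "coeff (poly_shift (k - d) (root_poly S x)) d = 1"
    using assms lead_coeff_root_poly[of S x] by (simp add: coeff_poly_shift)
  then show ?thesis by force
qed

text \<open>Coefficient \<open>i\<close> of \<open>q\<close> is one of the top coefficients of
  \<open>P_x\<close> and has size at most \<open>2 ^ k * N ^ (d - i)\<close>, so each of the
  \<open>d + 1\<close> terms is at most \<open>2 ^ k * N ^ d\<close>. Hence guessing the value
  \<open>q z0\<close> later costs only \<open>N ^ d\<close>.\<close>

lemma poly_shift_root_poly_bound:
  fixes N :: int
  assumes S: "finite S" "card S = k" "d \<le> k"
    and N: "\<And>i. i \<in> S \<Longrightarrow> \<bar>x i\<bar> \<le> N" "N \<ge> 1" "\<bar>z\<bar> \<le> N"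
  shows "\<bar>poly (poly_shift (k - d) (root_poly S x)) z\<bar> \<le> int (Suc d) * 2 ^ k * N ^ d"
proof -
  let ?c = "\<lambda>i. coeff (root_poly S x) (i + (k - d))"
  have "poly (poly_shift (k - d) (root_poly S x)) z = (\<Sum>i\<le>d. ?c i * z ^ i)"
    unfolding poly_altdef coeff_poly_shift[symmetric]
    by (intro sum.mono_neutral_left)
      (use degree_shift_root_poly[OF S(2,3)] in \<open>auto simp: coeff_eq_0\<close>)
  also have "\<bar>\<dots>\<bar> \<le> (\<Sum>i\<le>d. \<bar>?c i * z ^ i\<bar>)" by (rule sum_abs)
  also have "\<dots> \<le> (\<Sum>i\<le>d. 2 ^ k * N ^ d)"
  proof (rule sum_mono)
    fix i
    have "\<bar>?c i\<bar> * N ^ (i + (k - d)) \<le> 2 ^ k * N ^ k"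
      using coeff_root_poly_bound[of S x N "i + (k - d)"] S N by simp
    then have "(\<bar>?c i\<bar> * N ^ i) * N ^ (k - d) \<le> (2 ^ k * N ^ d) * N ^ (k - d)"
      using S(3) by (simp add: mult.assoc flip: power_add)
    then have "\<bar>?c i\<bar> * N ^ i \<le> 2 ^ k * N ^ d"
      using N(2) by (simp add: mult_le_cancel_right)
    moreover have "\<bar>?c i\<bar> * \<bar>z\<bar> ^ i \<le> \<bar>?c i\<bar> * N ^ i"
      using N by (intro mult_left_mono power_mono) auto
    ultimately show "\<bar>?c i * z ^ i\<bar> \<le> 2 ^ k * N ^ d"
      by (simp add: abs_mult power_abs)
  qed
  finally show ?thesis by simp
qed

text \<open>First a list \<open>f\<close> of \<open>m\<close> candidate values is chosen, then an
  entry of the list for each index.\<close>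

lemma card_few_values_le:
  assumes "finite W" "m \<ge> 1" "finite K" "K \<noteq> {}"
  shows "finite {y \<in> K \<rightarrow>\<^sub>E W. card (y ` K) \<le> m}"
    "card {y \<in> K \<rightarrow>\<^sub>E W. card (y ` K) \<le> m} \<le> card W ^ m * m ^ card K"
proof -
  let ?F = "{..<m} \<rightarrow>\<^sub>E W"
  have F: "finite ?F" "card ?F = card W ^ m"
    using assms(1) by (auto simp: finite_PiE card_funcsetE)
  have sub: "{y \<in> K \<rightarrow>\<^sub>E W. card (y ` K) \<le> m} \<subseteq> (\<Union>f\<in>?F. K \<rightarrow>\<^sub>E f ` {..<m})"
  proof
    fix y assume y: "y \<in> {y \<in> K \<rightarrow>\<^sub>E W. card (y ` K) \<le> m}"
    obtain w where w: "w \<in> y ` K" using assms(4) by auto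
    obtain b where b: "bij_betw b {0..<card (y ` K)} (y ` K)"
      using ex_bij_betw_nat_finite assms(3) by blast
    \<comment> \<open>If \<open>y\<close> has fewer than \<open>m\<close> values, the list is padded
      with the value \<open>w\<close>.\<close>
    define f where "f = (\<lambda>i\<in>{..<m}. if i < card (y ` K) then b i else w)"
    have fi: "f i \<in> y ` K" if "i < m" for i
      using that w bij_betw_apply[OF b, of i] by (auto simp: f_def)
    have "y ` K \<subseteq> W" using y by auto
    then have "f \<in> ?F" using fi by (auto simp: f_def)
    moreover have "y ` K \<subseteq> f ` {..<m}"
    proof
      fix v assume "v \<in> y ` K"
      then have "v \<in> b ` {0..<card (y ` K)}"
        using bij_betw_imp_surj_on[OF b] by blast
      then obtain i where "i < card (y ` K)" "b i = v"
        by auto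
      then show "v \<in> f ` {..<m}" using y by (intro image_eqI[of _ _ i]) (auto simp: f_def)
    qed
    then have "y \<in> K \<rightarrow>\<^sub>E f ` {..<m}" using y by (auto simp: PiE_iff)
    ultimately show "y \<in> (\<Union>f\<in>?F. K \<rightarrow>\<^sub>E f ` {..<m})" by blast
  qed
  have fin: "finite (\<Union>f\<in>?F. K \<rightarrow>\<^sub>E f ` {..<m})"
    using F assms(3) by (auto intro!: finite_PiE)
  then show "finite {y \<in> K \<rightarrow>\<^sub>E W. card (y ` K) \<le> m}" by (rule finite_subset[OF sub])
  have "card {y \<in> K \<rightarrow>\<^sub>E W. card (y ` K) \<le> m} \<le> card (\<Union>f\<in>?F. K \<rightarrow>\<^sub>E f ` {..<m})"
    by (rule card_mono[OF fin sub])
  also have "\<dots> \<le> (\<Sum>f\<in>?F. card (K \<rightarrow>\<^sub>E f ` {..<m}))"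
    by (rule card_UN_le[OF F(1)])
  also have "\<dots> \<le> (\<Sum>f\<in>?F. m ^ card K)"
  proof (rule sum_mono)
    fix f
    have "card (f ` {..<m}) \<le> m" using card_image_le[of "{..<m}" f] by simp
    then show "card (K \<rightarrow>\<^sub>E f ` {..<m}) \<le> m ^ card K"
      using assms(3) by (simp add: card_funcsetE power_mono)
  qed
  also have "\<dots> = card W ^ m * m ^ card K" using F by simp
  finally show "card {y \<in> K \<rightarrow>\<^sub>E W. card (y ` K) \<le> m} \<le> card W ^ m * m ^ card K" .
qed

lemma card_PiE_image_le:
  assumes "finite K"
  shows "finite (K \<rightarrow>\<^sub>E f ` K)" "card (K \<rightarrow>\<^sub>E f ` K) \<le> card K ^ card K"
  using assms card_image_le[OF assms, of f]
  by (auto simp: card_funcsetE power_mono intro!: finite_PiE)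

section \<open>Structure of non-diagonal solutions\<close>

text \<open>Different root polynomials encode that the tuples are not permutations of each other, in
  the form that yields \<open>h \<noteq> 0\<close> directly. The integer \<open>N\<close> will be
  the floor of \<open>X\<close>.\<close>

definition nondiag :: "nat \<Rightarrow> nat \<Rightarrow> int \<Rightarrow> ((nat \<Rightarrow> int) \<times> (nat \<Rightarrow> int)) set" where
  "nondiag k d N = {(x, y). x \<in> {1..k} \<rightarrow>\<^sub>E {1..N} \<and> y \<in> {1..k} \<rightarrow>\<^sub>E {1..N} \<and>
    (\<forall>j. 1 \<le> j \<and> j \<le> k \<and> j \<noteq> k - d \<longrightarrow> (\<Sum>i=1..k. x i ^ j) = (\<Sum>i=1..k. y i ^ j)) \<and>
    root_poly {1..k} x \<noteq> root_poly {1..k} y}"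

abbreviation shifted :: "nat \<Rightarrow> nat \<Rightarrow> (nat \<Rightarrow> int) \<Rightarrow> int poly" where
  "shifted k d x \<equiv> poly_shift (k - d) (root_poly {1..k} x)"

lemma nondiag_sym: "(x, y) \<in> nondiag k d N \<Longrightarrow> (y, x) \<in> nondiag k d N"
  by (auto simp: nondiag_def)

text \<open>The difference \<open>h * q\<close> has degree at most \<open>d < k - d\<close>, so the
  top coefficients of both root polynomials agree and \<open>q\<close> can be formed from
  \<open>x\<close> alone.\<close>

lemma nondiag_diff:
  assumes "(x, y) \<in> nondiag k d N" "2 * d < k"
  shows "\<exists>h. h \<noteq> 0 \<and> root_poly {1..k} x - root_poly {1..k} y = smult h (shifted k d x) \<and>
    shifted k d y = shifted k d x"
proof -
  obtain h where h: "root_poly {1..k} x - root_poly {1..k} y = smult h (shifted k d y)"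
    using root_poly_diff[of "{1..k}" k d x y] assms by (auto simp: nondiag_def)
  have "h \<noteq> 0" using h assms by (auto simp: nondiag_def)
  moreover have "shifted k d y = shifted k d x"
  proof (rule poly_eqI)
    fix i
    have "coeff (shifted k d y) (i + (k - d)) = 0"
      using degree_shift_root_poly[of "{1..k}" k d y] assms(2) by (intro coeff_eq_0) auto
    then have "coeff (root_poly {1..k} x - root_poly {1..k} y) (i + (k - d)) = 0"
      unfolding h by simp
    then show "coeff (shifted k d y) i = coeff (shifted k d x) i"
      by (simp add: coeff_poly_shift)
  qed
  ultimately show ?thesis using h by metis
qed

text \<open>At a value \<open>v\<close> of \<open>y\<close> we have \<open>P_x(v) = h q(v)\<close>,
  and this is nonzero as \<open>v\<close> is not a value of \<open>x\<close>. So \<open>v\<close>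
  and \<open>x\<close> determine \<open>h\<close>, hence \<open>P_y\<close> and the set of values of
  \<open>y\<close>; at most \<open>k ^ k\<close> tuples take values in that set.\<close>

lemma card_nondiag_fibre:
  fixes x :: "nat \<Rightarrow> int"
  assumes d: "2 * d < k"
  shows "finite {y. (x, y) \<in> nondiag k d N \<and> v \<in> y ` {1..k} - x ` {1..k}}"
    "card {y. (x, y) \<in> nondiag k d N \<and> v \<in> y ` {1..k} - x ` {1..k}} \<le> k ^ k"
proof -
  let ?A = "{y. (x, y) \<in> nondiag k d N \<and> v \<in> y ` {1..k} - x ` {1..k}}"
  have *: "\<exists>y0. ?A \<subseteq> {1..k} \<rightarrow>\<^sub>E y0 ` {1..k}"
  proof (cases "?A = {}")
    case False
    then obtain y0 where y0: "y0 \<in> ?A" by blast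
    have key: "\<exists>h. root_poly {1..k} y = root_poly {1..k} x - smult h (shifted k d x) \<and>
      poly (root_poly {1..k} x) v = h * poly (shifted k d x) v" if "y \<in> ?A" for y
    proof -
      from that have y: "(x, y) \<in> nondiag k d N" "v \<in> y ` {1..k}" by auto
      obtain h where h: "root_poly {1..k} x - root_poly {1..k} y = smult h (shifted k d x)"
        using nondiag_diff[OF y(1) d] by blast
      have "poly (root_poly {1..k} y) v = 0"
        using y(2) by (simp add: poly_root_poly_eq_0_iff)
      then have "poly (root_poly {1..k} x) v = h * poly (shifted k d x) v"
        using arg_cong[OF h, of "\<lambda>p. poly p v"] by simp
      moreover have "root_poly {1..k} y = root_poly {1..k} x - smult h (shifted k d x)"
        unfolding h[symmetric] by simp
      ultimately show ?thesis by blast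
    qed
    have xv: "poly (root_poly {1..k} x) v \<noteq> 0"
      using y0 by (simp add: poly_root_poly_eq_0_iff)
    have "y \<in> {1..k} \<rightarrow>\<^sub>E y0 ` {1..k}" if y: "y \<in> ?A" for y
    proof -
      have "root_poly {1..k} y = root_poly {1..k} y0"
        using key[OF y] key[OF y0] xv by (metis mult_cancel_right mult_zero_right)
      then have "v \<in> y ` {1..k} \<longleftrightarrow> v \<in> y0 ` {1..k}" for v
        by (simp add: poly_root_poly_eq_0_iff[symmetric])
      then show ?thesis
        using y by (auto simp: nondiag_def PiE_iff)
    qed
    then show ?thesis by blast
  qed auto
  then obtain y0 where "?A \<subseteq> {1..k} \<rightarrow>\<^sub>E y0 ` {1..k}" by blast
  moreover have "finite ({1..k} \<rightarrow>\<^sub>E y0 ` {1..k})" "card ({1..k} \<rightarrow>\<^sub>E y0 ` {1..k}) \<le> k ^ k"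
    using card_PiE_image_le[of "{1..k}" y0] by auto
  ultimately show "finite ?A" "card ?A \<le> k ^ k"
    by (meson finite_subset, meson card_mono order_trans)
qed

lemma card_common_values_le:
  assumes xy: "(x, y) \<in> nondiag k d N" and d: "2 * d < k"
  shows "card (y ` {1..k} \<inter> x ` {1..k}) \<le> d"
proof -
  obtain h where h: "h \<noteq> 0" "root_poly {1..k} x - root_poly {1..k} y = smult h (shifted k d x)"
    using nondiag_diff[OF xy d] by blast
  have nz: "shifted k d x \<noteq> 0" using shift_root_poly_nonzero[of "{1..k}" k d x] d by simp
  have "y ` {1..k} \<inter> x ` {1..k} \<subseteq> {v. poly (shifted k d x) v = 0}"
  proof
    fix v assume "v \<in> y ` {1..k} \<inter> x ` {1..k}"
    then have "poly (root_poly {1..k} x) v = 0" "poly (root_poly {1..k} y) v = 0"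
      by (simp_all add: poly_root_poly_eq_0_iff)
    then show "v \<in> {v. poly (shifted k d x) v = 0}"
      using arg_cong[OF h(2), of "\<lambda>p. poly p v"] h(1) by simp
  qed
  then have "card (y ` {1..k} \<inter> x ` {1..k}) \<le> card {v. poly (shifted k d x) v = 0}"
    using nz by (intro card_mono poly_roots_finite)
  also have "\<dots> \<le> degree (shifted k d x)"
    by (rule card_poly_roots_bound[OF nz])
  also have "\<dots> \<le> d" using degree_shift_root_poly[of "{1..k}" k d x] d by simp
  finally show ?thesis .
qed

lemma finite_nondiag: "finite (nondiag k d N)"
  by (rule finite_subset[of _ "({1..k} \<rightarrow>\<^sub>E {1..N}) \<times> ({1..k} \<rightarrow>\<^sub>E {1..N})"])
    (auto simp: nondiag_def intro!: finite_PiE)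

text \<open>Here \<open>y\<close> has at most \<open>r - 1 + d\<close> distinct values, since at
  most \<open>d\<close> are shared with \<open>x\<close>. Given \<open>y\<close>, either all values
  of \<open>x\<close> occur in \<open>y\<close>, or a new value \<open>v\<close>, with
  \<open>N\<close> choices, determines \<open>x\<close> up to \<open>k ^ k\<close> possibilities by
  the fibre bound with the roles exchanged.\<close>

lemma card_nondiag_degenerate:
  assumes d: "2 * d < k" and r: "r \<ge> 2" and N: "N \<ge> 1"
  shows "card {(x, y) \<in> nondiag k d N. card (y ` {1..k} - x ` {1..k}) < r}
    \<le> (2 * k ^ k * (r - 1 + d) ^ k) * nat N ^ (r + d)"
proof -
  let ?K = "{1..k}"
  let ?D = "{(x, y) \<in> nondiag k d N. card (y ` ?K - x ` ?K) < r}"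
  let ?m = "r - 1 + d"
  let ?Y = "{y \<in> ?K \<rightarrow>\<^sub>E {1..N}. card (y ` ?K) \<le> ?m}"
  have Y: "finite ?Y" "card ?Y \<le> nat N ^ ?m * ?m ^ k"
    using card_few_values_le[of "{1..N}" ?m ?K] r d by auto
  define V where "V y v = {x. (y, x) \<in> nondiag k d N \<and> v \<in> x ` ?K - y ` ?K}" for y v
  define G where "G y = (?K \<rightarrow>\<^sub>E y ` ?K) \<union> (\<Union>v\<in>{1..N}. V y v)" for y :: "nat \<Rightarrow> int"
  have V: "finite (V y v)" "card (V y v) \<le> k ^ k" for y v
    unfolding V_def by (rule card_nondiag_fibre[OF d])+
  have G: "finite (G y)" "card (G y) \<le> 2 * k ^ k * nat N" for y
  proof -
    have *: "finite (?K \<rightarrow>\<^sub>E y ` ?K)" "card (?K \<rightarrow>\<^sub>E y ` ?K) \<le> k ^ k"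
      using card_PiE_image_le[of ?K y] by auto
    show "finite (G y)" unfolding G_def using * V by auto
    have "card (\<Union>v\<in>{1..N}. V y v) \<le> (\<Sum>v\<in>{1..N}. card (V y v))"
      by (rule card_UN_le) simp
    also have "\<dots> \<le> (\<Sum>v\<in>{1..N}. k ^ k)" by (intro sum_mono V)
    finally have "card (\<Union>v\<in>{1..N}. V y v) \<le> nat N * k ^ k" by simp
    then have "card (G y) \<le> k ^ k + nat N * k ^ k"
      unfolding G_def using * by (meson add_mono card_Un_le order_trans)
    also have "\<dots> \<le> 2 * k ^ k * nat N"
    proof -
      have "1 * k ^ k \<le> nat N * k ^ k" using N by (intro mult_le_mono1) simp
      then show ?thesis by (simp add: mult.commute mult.left_commute)
    qed
    finally show "card (G y) \<le> 2 * k ^ k * nat N" .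
  qed
  have "?D \<subseteq> prod.swap ` Sigma ?Y G"
  proof clarify
    fix x y assume xy: "(x, y) \<in> nondiag k d N" "card (y ` ?K - x ` ?K) < r"
    have "card (y ` ?K) = card (y ` ?K - x ` ?K) + card (y ` ?K \<inter> x ` ?K)"
      by (subst card_Un_disjoint[symmetric]) (auto intro!: arg_cong[where f = card])
    then have "y \<in> ?Y"
      using xy card_common_values_le[OF xy(1) d] by (auto simp: nondiag_def)
    moreover have "x \<in> G y"
    proof (cases "x ` ?K \<subseteq> y ` ?K")
      case True
      then show ?thesis using xy by (auto simp: G_def nondiag_def PiE_iff)
    next
      case False
      then obtain v where v: "v \<in> x ` ?K - y ` ?K" by blast
      moreover from this have "v \<in> {1..N}" using xy by (auto simp: nondiag_def)
      ultimately show ?thesis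
        using nondiag_sym[OF xy(1)] by (auto simp: G_def V_def)
    qed
    ultimately show "(x, y) \<in> prod.swap ` Sigma ?Y G" by force
  qed
  moreover have fin: "finite (Sigma ?Y G)" using Y G by blast
  ultimately have "card ?D \<le> card (Sigma ?Y G)"
    by (meson card_image_le card_mono finite_imageI order_trans)
  also have "\<dots> = (\<Sum>y\<in>?Y. card (G y))"
    using Y G by (intro card_SigmaI) auto
  also have "\<dots> \<le> (\<Sum>y\<in>?Y. 2 * k ^ k * nat N)" by (intro sum_mono G)
  also have "\<dots> \<le> (nat N ^ ?m * ?m ^ k) * (2 * k ^ k * nat N)"
    using mult_le_mono1[OF Y(2)] by (simp only: sum_constant of_nat_id)
  also have "\<dots> = (2 * k ^ k * ?m ^ k) * nat N ^ Suc ?m"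
    by (simp add: algebra_simps)
  also have "Suc ?m = r + d" using r by simp
  finally show ?thesis .
qed

lemma card_bounded_powers_le:
  fixes N :: int
  assumes r: "r \<ge> 1" and N: "N \<ge> 1"
  shows "finite {B::int. 0 < B \<and> B ^ r \<le> N ^ k}"
    "real (card {B::int. 0 < B \<and> B ^ r \<le> N ^ k}) \<le> real_of_int N powr (real k / real r)"
proof -
  let ?A = "{B::int. 0 < B \<and> B ^ r \<le> N ^ k}" and ?b = "real_of_int N powr (real k / real r)"
  have "?A \<subseteq> {1..\<lfloor>?b\<rfloor>}"
  proof
    fix B assume B: "B \<in> ?A"
    then have "real_of_int (B ^ r) \<le> real_of_int (N ^ k)"
      by (subst of_int_le_iff) simp
    then have "(real_of_int B powr real r) powr (1 / real r) \<le> (real_of_int N powr real k) powr (1 / real r)"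
      using B N by (intro powr_mono2) (auto simp: powr_realpow)
    then have "real_of_int B \<le> ?b"
      using r B N by (simp add: powr_powr)
    then show "B \<in> {1..\<lfloor>?b\<rfloor>}" using B by (simp add: le_floor_iff)
  qed
  moreover from this have "card ?A \<le> card {1..\<lfloor>?b\<rfloor>}" by (intro card_mono) auto
  ultimately show "finite ?A" "real (card ?A) \<le> ?b"
    by (auto intro: finite_subset simp: of_nat_le_iff)
      (smt (verit) of_int_floor_le of_nat_nat of_nat_mono powr_ge_zero zero_le_floor)
qed

lemma card_off_diagonal_le:
  assumes "finite Z"
  shows "card {(a, b). a \<in> Z \<and> b \<in> Z \<and> a \<noteq> b} \<le> card Z * card Z"
proof -
  have "card {(a, b). a \<in> Z \<and> b \<in> Z \<and> a \<noteq> b} \<le> card (Z \<times> Z)"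
    using assms by (intro card_mono) auto
  then show ?thesis by (simp add: card_cartesian_product)
qed

section \<open>Encoding solutions with many new values\<close>

text \<open>This is the multiple of \<open>z0 - x s\<close> from
  \<open>exists_recursive_divisibility\<close>, with \<open>q z0\<close> replaced by a free
  parameter \<open>Q\<close>. It reads only the entries of \<open>g\<close> before \<open>s\<close>,
  as sequential counting requires.\<close>

definition control :: "nat \<Rightarrow> int set \<Rightarrow> int \<Rightarrow> int \<Rightarrow> nat \<Rightarrow> (nat \<Rightarrow> int) \<Rightarrow> int" where
  "control k Z B Q s g = (\<Prod>(a, b)\<in>{(a, b). a \<in> Z \<and> b \<in> Z \<and> a \<noteq> b}. a - b) ^ k * B * Q *
    (\<Prod>t\<in>{1..<s}. \<Prod>z\<in>Z. z - g t)"

lemma control_restrict: "control k Z B Q s (restrict x {1..<s}) = control k Z B Q s x"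
  by (simp add: control_def)

text \<open>A polynomial bound in \<open>N\<close> is what makes the divisor bound cost only
  \<open>N powr \<epsilon>\<close>. The four exponents come from the differences
  \<open>a - b\<close>, from \<open>B\<close>, from \<open>Q\<close> and from the factors
  \<open>z - x t\<close>.\<close>

lemma control_bound:
  fixes N :: int
  assumes N: "N \<ge> 1" and Z: "Z \<subseteq> {1..N}" "card Z = r"
    and x: "\<And>i. i \<in> {1..k} \<Longrightarrow> x i \<in> {1..N}" and s: "s \<in> {1..k}"
    and B: "\<bar>B\<bar> \<le> N ^ k" and Q: "\<bar>Q\<bar> \<le> C * N ^ d"
  shows "\<bar>control k Z B Q s x\<bar> \<le> C * N ^ (r * r * k + k + d + r * k)"
proof -
  let ?P = "{(a, b). a \<in> Z \<and> b \<in> Z \<and> a \<noteq> b}"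
  have fin: "finite Z" using Z finite_subset by blast
  have "\<bar>\<Prod>(a, b)\<in>?P. a - b\<bar> \<le> N ^ (r * r)"
  proof (rule abs_prod_le_power)
    fix p assume "p \<in> ?P"
    then have "fst p \<in> {1..N}" "snd p \<in> {1..N}" using Z by auto
    then show "\<bar>case p of (a, b) \<Rightarrow> a - b\<bar> \<le> N" by (auto simp: case_prod_unfold)
  qed (use card_off_diagonal_le[OF fin] Z N in auto)
  then have 1: "\<bar>(\<Prod>(a, b)\<in>?P. a - b) ^ k\<bar> \<le> N ^ (r * r * k)"
    by (simp add: power_abs power_mult power_mono)
  have "\<bar>\<Prod>z\<in>Z. z - x t\<bar> \<le> N ^ r" if "t \<in> {1..<s}" for t
  proof (rule abs_prod_le_power)
    fix z assume "z \<in> Z"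
    then have "z \<in> {1..N}" "x t \<in> {1..N}" using Z x[of t] s that by auto
    then show "\<bar>z - x t\<bar> \<le> N" by auto
  qed (use Z N in auto)
  then have "\<bar>\<Prod>t\<in>{1..<s}. \<Prod>z\<in>Z. z - x t\<bar> \<le> (N ^ r) ^ k"
    by (rule abs_prod_le_power) (use N s in auto)
  then have 2: "\<bar>\<Prod>t\<in>{1..<s}. \<Prod>z\<in>Z. z - x t\<bar> \<le> N ^ (r * k)"
    by (simp add: power_mult)
  have C: "0 \<le> C * N ^ d" using Q by linarith
  have "\<bar>control k Z B Q s x\<bar> \<le> N ^ (r * r * k) * N ^ k * (C * N ^ d) * N ^ (r * k)"
    unfolding control_def abs_mult
    using 1 2 B Q C N by (intro mult_mono) auto
  then show ?thesis by (simp add: power_add mult_ac)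
qed

text \<open>The code consists of \<open>r\<close> new values \<open>Z\<close> of \<open>y\<close>,
  the distinguished \<open>z0\<close>, the integer \<open>B\<close> and \<open>Q = q z0\<close>; it
  makes \<open>x\<close> recoverable up to few choices.\<close>

lemma nondiag_code:
  assumes xy: "(x, y) \<in> nondiag k d N" and d: "2 * d < k" and r: "r \<ge> 2"
    and c: "r \<le> card (y ` {1..k} - x ` {1..k})"
  shows "\<exists>Z z0 B Q. Z \<subseteq> {1..N} \<and> card Z = r \<and> z0 \<in> Z \<and> Z \<subseteq> y ` {1..k} - x ` {1..k} \<and>
    0 < B \<and> B ^ r \<le> N ^ k \<and> Q \<noteq> 0 \<and> \<bar>Q\<bar> \<le> int (Suc d) * 2 ^ k * N ^ d \<and>
    (\<forall>s\<in>{1..k}. z0 - x s dvd control k Z B Q s x)"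
proof -
  have x: "x i \<in> {1..N}" and y: "y i \<in> {1..N}" if "i \<in> {1..k}" for i
    using xy that by (auto simp: nondiag_def PiE_iff)
  have N: "N \<ge> 1" using x[of 1] d by auto
  obtain Z where Z: "Z \<subseteq> y ` {1..k} - x ` {1..k}" "card Z = r"
    using obtain_subset_with_card_n[OF c] by metis
  have ZN: "Z \<subseteq> {1..N}" using Z y by auto
  have finZ: "finite Z" "Z \<noteq> {}" using Z r finite_subset[OF ZN] by auto
  obtain h where h: "h \<noteq> 0" "root_poly {1..k} x - root_poly {1..k} y = smult h (shifted k d x)"
    using nondiag_diff[OF xy d] by blast
  define q where "q z = poly (shifted k d x) z" for z
  have eq: "(\<Prod>i\<in>{1..k}. z - x i) = h * q z" if "z \<in> Z" for z
  proof -
    have "poly (root_poly {1..k} y) z = 0"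
      using that Z by (auto simp: poly_root_poly_eq_0_iff)
    then show ?thesis
      using arg_cong[OF h(2), of "\<lambda>p. poly p z"] by (simp add: q_def flip: poly_root_poly)
  qed
  obtain z0 B where zB: "z0 \<in> Z" "B > 0" "B ^ card Z \<le> \<bar>h\<bar>"
    "\<forall>s\<in>{1..k}. z0 - x s dvd control k Z B (q z0) s x"
    using exists_recursive_divisibility[OF h(1) finZ eq] unfolding control_def by blast
  have "z0 - x i \<noteq> 0" if "i \<in> {1..k}" for i
    using zB(1) Z(1) imageI[OF that, of x] by auto
  then have q0: "q z0 \<noteq> 0"
    using eq[OF zB(1)] by (metis (no_types, lifting) finite_atLeastAtMost mult_zero_right prod_zero_iff)
  have z0: "z0 \<in> {1..N}" using zB(1) ZN by blast
  \<comment> \<open>The nonzero integer \<open>q z0\<close> has absolute value at least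
    \<open>1\<close>, so \<open>h\<close> is bounded by the product of the \<open>k\<close>
    differences \<open>z0 - x i\<close>.\<close>
  have "\<bar>h\<bar> * 1 \<le> \<bar>h\<bar> * \<bar>q z0\<bar>"
    using q0 by (intro mult_left_mono) auto
  also have "\<dots> = \<bar>\<Prod>i\<in>{1..k}. z0 - x i\<bar>" by (simp only: eq[OF zB(1)] abs_mult)
  also have "\<dots> \<le> N ^ k"
    using x z0 N by (intro abs_prod_le_power) (fastforce simp: abs_le_iff)+
  finally have "B ^ r \<le> N ^ k" using zB(3) Z by simp
  moreover have "\<bar>q z0\<bar> \<le> int (Suc d) * 2 ^ k * N ^ d"
    unfolding q_def using x z0 N d by (intro poly_shift_root_poly_bound) (fastforce simp: abs_le_iff)+
  ultimately show ?thesis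
    using Z ZN zB q0 by blast
qed

text \<open>With the code fixed, each \<open>x s\<close> comes from a divisor of an integer known
  from the previous entries, with \<open>2 * M\<close> choices counting signs. Then
  \<open>z0\<close> is a value of \<open>y\<close> outside \<open>x\<close>, and the fibre bound
  leaves \<open>k ^ k\<close> choices for \<open>y\<close>.\<close>

lemma card_code_fibre:
  fixes N C :: int
  assumes d: "2 * d < k" and r: "r \<ge> 2" and N: "N \<ge> 1"
    and Z: "Z \<subseteq> {1..N}" "card Z = r" "z0 \<in> Z"
    and B: "0 < B" "B ^ r \<le> N ^ k" and Q: "Q \<noteq> 0" "\<bar>Q\<bar> \<le> C * N ^ d"
    and M: "\<And>n. 0 < n \<Longrightarrow> int n \<le> C * N ^ (r * r * k + k + d + r * k) \<Longrightarrow> card {e. e dvd n} \<le> M"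
  shows "card {(x, y) \<in> nondiag k d N. Z \<subseteq> y ` {1..k} - x ` {1..k} \<and>
    (\<forall>s\<in>{1..k}. z0 - x s dvd control k Z B Q s x)} \<le> (2 * M) ^ k * k ^ k"
proof -
  define S where "S = {(x, y) \<in> nondiag k d N. Z \<subseteq> y ` {1..k} - x ` {1..k} \<and>
    (\<forall>s\<in>{1..k}. z0 - x s dvd control k Z B Q s x)}"
  define V where "V x = {y. (x, y) \<in> nondiag k d N \<and> z0 \<in> y ` {1..k} - x ` {1..k}}" for x
  define A where "A s g = {v. z0 - v dvd control k Z B Q s g}" for s g
  have V: "finite (V x)" "card (V x) \<le> k ^ k" for x
    unfolding V_def by (rule card_nondiag_fibre[OF d])+
  have finZ: "finite Z" using Z(1) finite_subset by blast
  have "B ^ 1 \<le> B ^ r" using B r by (intro power_increasing) auto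
  then have BN: "\<bar>B\<bar> \<le> N ^ k" using B by simp
  have SA: "x s \<in> A s x" if "x \<in> fst ` S" "s \<in> {1..k}" for x s
    using that by (auto simp: S_def A_def)
  have A: "finite (A s x) \<and> card (A s x) \<le> 2 * M" if x: "x \<in> fst ` S" and s: "s \<in> {1..k}" for x s
  proof -
    let ?c = "control k Z B Q s x"
    have xN: "x i \<in> {1..N}" if "i \<in> {1..k}" for i
      using x that by (auto simp: S_def nondiag_def PiE_iff)
    \<comment> \<open>\<open>Z\<close> avoids the values of \<open>x\<close>; this keeps the control
      integer nonzero and its set of divisors finite.\<close>
    have "z - x t \<noteq> 0" if "z \<in> Z" "t \<in> {1..<s}" for z t
      using x s that by (force simp: S_def)
    moreover have "finite {(a, b). a \<in> Z \<and> b \<in> Z \<and> a \<noteq> b}"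
      by (rule finite_subset[of _ "Z \<times> Z"]) (use finZ in auto)
    ultimately have c: "?c \<noteq> 0"
      using B(1) Q(1) finZ by (auto simp: control_def)
    have cle: "\<bar>?c\<bar> \<le> C * N ^ (r * r * k + k + d + r * k)"
      by (rule control_bound[OF N Z(1,2) xN s BN Q(2)])
    have "A s x \<subseteq> (\<lambda>e. z0 - e) ` {e. e dvd ?c}"
    proof
      fix v assume "v \<in> A s x"
      then show "v \<in> (\<lambda>e. z0 - e) ` {e. e dvd ?c}"
        by (intro image_eqI[of _ _ "z0 - v"]) (auto simp: A_def)
    qed
    moreover have "finite {e. e dvd ?c}" "card {e. e dvd ?c} \<le> 2 * M"
      using card_int_divisors[OF c] M[of "nat \<bar>?c\<bar>"] c cle by auto
    ultimately show ?thesis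
      by (meson card_image_le card_mono finite_imageI finite_subset order_trans)
  qed
  have restr: "A s (restrict x {1..<s}) = A s x" for x s
    by (simp only: A_def control_restrict)
  have F: "finite (fst ` S) \<and> card (fst ` S) \<le> (2 * M) ^ k"
  proof (rule card_sequential_le[where A = A])
    show "x \<in> extensional {1..k}" if "x \<in> fst ` S" for x
      using that by (auto simp: S_def nondiag_def PiE_iff)
  qed (use SA A restr in auto)
  have "S \<subseteq> Sigma (fst ` S) V"
    using Z(3) by (force simp: S_def V_def)
  then have "card S \<le> card (Sigma (fst ` S) V)"
    using F V by (intro card_mono) auto
  also have "\<dots> = (\<Sum>x\<in>fst ` S. card (V x))"
    using F V by (intro card_SigmaI) auto
  also have "\<dots> \<le> (\<Sum>x\<in>fst ` S. k ^ k)" by (intro sum_mono V)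
  also have "\<dots> \<le> (2 * M) ^ k * k ^ k"
    using F by (simp add: mult_le_mono1)
  finally show ?thesis unfolding S_def .
qed

text \<open>The number of codes is multiplied by the size of a code fibre: \<open>N ^ r * r\<close>
  choices for \<open>Z\<close> and \<open>z0\<close>, then those for \<open>B\<close> and for
  \<open>Q\<close>.\<close>

lemma card_nondiag_nondegenerate:
  fixes N :: int
  assumes d: "2 * d < k" and r: "r \<ge> 2" and N: "N \<ge> 1"
    and C: "C = int (Suc d) * 2 ^ k"
    and M: "\<And>n. 0 < n \<Longrightarrow> int n \<le> C * N ^ (r * r * k + k + d + r * k) \<Longrightarrow> card {e. e dvd n} \<le> M"
  shows "card {(x, y) \<in> nondiag k d N. r \<le> card (y ` {1..k} - x ` {1..k})} \<le>
    (nat N ^ r * r) * card {B. 0 < B \<and> B ^ r \<le> N ^ k} * nat (3 * C * N ^ d) * ((2 * M) ^ k * k ^ k)"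
proof -
  define ZS where "ZS = {Z. Z \<subseteq> {1..N} \<and> card Z = r}"
  define BS where "BS = {B. 0 < B \<and> B ^ r \<le> N ^ k}"
  define QS where "QS = {Q. Q \<noteq> 0 \<and> \<bar>Q\<bar> \<le> C * N ^ d}"
  define D where "D = (SIGMA Z:ZS. Z) \<times> BS \<times> QS"
  define S where "S = (\<lambda>((Z, z0), B, Q). {(x, y) \<in> nondiag k d N. Z \<subseteq> y ` {1..k} - x ` {1..k} \<and>
    (\<forall>s\<in>{1..k}. z0 - x s dvd control k Z B Q s x)})"
  have ZS: "finite ZS" "card ZS \<le> nat N ^ r"
  proof -
    show "finite ZS" by (rule finite_subset[of _ "Pow {1..N}"]) (auto simp: ZS_def)
    have "card ZS = nat N choose r"
      unfolding ZS_def by (subst n_subsets) auto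
    also have "\<dots> \<le> nat N ^ r"
      by (cases "r \<le> nat N") (auto simp: binomial_le_pow binomial_eq_0)
    finally show "card ZS \<le> nat N ^ r" .
  qed
  have finZ: "finite Z" if "Z \<in> ZS" for Z
    using that finite_subset[of Z "{1..N}"] by (auto simp: ZS_def)
  have "card (SIGMA Z:ZS. Z) = (\<Sum>Z\<in>ZS. card Z)"
    using ZS finZ by (intro card_SigmaI) auto
  also have "\<dots> = (\<Sum>Z\<in>ZS. r)" by (intro sum.cong) (auto simp: ZS_def)
  also have "\<dots> \<le> nat N ^ r * r"
    using mult_le_mono1[OF ZS(2)] by simp
  finally have ZZ: "finite (SIGMA Z:ZS. Z)" "card (SIGMA Z:ZS. Z) \<le> nat N ^ r * r"
    using ZS finZ by auto
  have BS: "finite BS" unfolding BS_def using card_bounded_powers_le[OF _ N, of r k] r by simp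
  have sub: "QS \<subseteq> {- (C * N ^ d)..C * N ^ d}" by (auto simp: QS_def)
  have "1 * 1 \<le> int (Suc d) * 2 ^ k" by (intro mult_mono) auto
  \<comment> \<open>This lets \<open>2 * C * N ^ d + 1\<close>, the size of the interval containing
    \<open>Q\<close>, be replaced by \<open>3 * C * N ^ d\<close>.\<close>
  then have CN: "C * N ^ d \<ge> 1"
    using mult_mono[of 1 C 1 "N ^ d"] N by (simp add: C)
  have "card QS \<le> nat (2 * (C * N ^ d) + 1)"
    using card_mono[OF _ sub] by (simp add: algebra_simps)
  also have "\<dots> \<le> nat (3 * C * N ^ d)" using CN by (intro nat_mono) linarith
  finally have QS: "finite QS" "card QS \<le> nat (3 * C * N ^ d)"
    using sub finite_subset by auto
  have D: "finite D" "card D \<le> (nat N ^ r * r) * card BS * nat (3 * C * N ^ d)"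
  proof -
    show "finite D" unfolding D_def using ZZ(1) BS QS(1) by blast
    have "card D = card (SIGMA Z:ZS. Z) * (card BS * card QS)"
      by (simp only: D_def card_cartesian_product)
    also have "\<dots> \<le> (nat N ^ r * r) * (card BS * nat (3 * C * N ^ d))"
      by (intro mult_le_mono ZZ QS order_refl)
    finally show "card D \<le> (nat N ^ r * r) * card BS * nat (3 * C * N ^ d)"
      by (simp only: mult.assoc)
  qed
  have fib: "card (S c) \<le> (2 * M) ^ k * k ^ k" if "c \<in> D" for c
  proof -
    obtain Z z0 B Q where c: "c = ((Z, z0), B, Q)" by (metis surj_pair)
    with that have "Z \<subseteq> {1..N}" "card Z = r" "z0 \<in> Z" "0 < B" "B ^ r \<le> N ^ k" "Q \<noteq> 0"
      "\<bar>Q\<bar> \<le> C * N ^ d" by (auto simp: D_def ZS_def BS_def QS_def)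
    from card_code_fibre[OF d r N this M] show ?thesis
      by (simp add: c S_def)
  qed
  have finS: "finite (S c)" for c
    by (rule finite_subset[OF _ finite_nondiag[of k d N]]) (auto simp: S_def)
  have "{(x, y) \<in> nondiag k d N. r \<le> card (y ` {1..k} - x ` {1..k})} \<subseteq> (\<Union>c\<in>D. S c)"
  proof clarify
    fix x y assume "(x, y) \<in> nondiag k d N" "r \<le> card (y ` {1..k} - x ` {1..k})"
    moreover from nondiag_code[OF this(1) d r this(2)] obtain Z z0 B Q where
      "Z \<subseteq> {1..N}" "card Z = r" "z0 \<in> Z" "Z \<subseteq> y ` {1..k} - x ` {1..k}"
      "0 < B" "B ^ r \<le> N ^ k" "Q \<noteq> 0" "\<bar>Q\<bar> \<le> C * N ^ d"
      "\<forall>s\<in>{1..k}. z0 - x s dvd control k Z B Q s x" unfolding C by metis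
    ultimately have "((Z, z0), B, Q) \<in> D" "(x, y) \<in> S ((Z, z0), B, Q)"
      by (auto simp: D_def ZS_def BS_def QS_def S_def)
    then show "(x, y) \<in> (\<Union>c\<in>D. S c)" by blast
  qed
  then have "card {(x, y) \<in> nondiag k d N. r \<le> card (y ` {1..k} - x ` {1..k})} \<le> card (\<Union>c\<in>D. S c)"
    using D finS by (intro card_mono) auto
  also have "\<dots> \<le> (\<Sum>c\<in>D. card (S c))" by (rule card_UN_le[OF D(1)])
  also have "\<dots> \<le> (\<Sum>c\<in>D. (2 * M) ^ k * k ^ k)" by (intro sum_mono fib)
  also have "\<dots> = card D * ((2 * M) ^ k * k ^ k)" by simp
  also have "\<dots> \<le> (nat N ^ r * r) * card BS * nat (3 * C * N ^ d) * ((2 * M) ^ k * k ^ k)"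
    by (rule mult_le_mono1[OF D(2)])
  finally show ?thesis unfolding BS_def .
qed

text \<open>Solutions are split by whether \<open>y\<close> has at least \<open>r\<close> values
  outside \<open>x\<close>. The degenerate ones contribute exponent \<open>r + d\<close>, the others
  \<open>r + k / r + d + \<epsilon>\<close>.\<close>

lemma card_nondiag_le:
  fixes \<epsilon> :: real
  assumes d: "2 * d < k" and r: "r \<ge> 2" and \<epsilon>: "\<epsilon> > 0"
  shows "\<exists>c\<ge>0. \<forall>N::int. N \<ge> 1 \<longrightarrow>
    real (card (nondiag k d N)) \<le> c * real_of_int N powr (real r + real d + real k / real r + \<epsilon>)"
proof -
  define L where "L = r * r * k + k + d + r * k"
  have L: "L > 0" and k: "k > 0" using d by (auto simp: L_def)
  \<comment> \<open>The divisor bound is applied once per coordinate to integers of size at most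
    \<open>C * N ^ L\<close>, so the total cost in \<open>N\<close> is
    \<open>(N powr (L * \<delta>)) ^ k = N powr \<epsilon>\<close>.\<close>
  define \<delta> where "\<delta> = \<epsilon> / (real L * real k)"
  have \<delta>: "\<delta> > 0" using \<epsilon> L k by (simp add: \<delta>_def)
  obtain Cd where Cd: "Cd \<ge> 1" "\<And>n::nat. n > 0 \<Longrightarrow> real (card {e. e dvd n}) \<le> Cd * real n powr \<delta>"
    using divisor_bound[OF \<delta>] by blast
  define C where "C = int (Suc d) * 2 ^ k"
  have C: "real_of_int C \<ge> 0" by (simp add: C_def)
  define c1 where "c1 = real (2 * k ^ k * (r - 1 + d) ^ k)"
  define c2 where "c2 = real r * (3 * real_of_int C) * (2 * (Cd * real_of_int C powr \<delta>)) ^ k * real (k ^ k)"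
  have "real (card (nondiag k d N)) \<le>
      (c1 + c2) * real_of_int N powr (real r + real d + real k / real r + \<epsilon>)" if N: "N \<ge> 1" for N :: int
  proof -
    let ?n = "real_of_int N"
    have n: "?n \<ge> 1" "real (nat N) = ?n" using N by auto
    define M where "M = nat \<lfloor>Cd * (real_of_int C * ?n ^ L) powr \<delta>\<rfloor>"
    have M0: "Cd * (real_of_int C * ?n ^ L) powr \<delta> \<ge> 0" using Cd by simp
    have M: "card {e. e dvd n} \<le> M" if "0 < n" "int n \<le> C * N ^ L" for n :: nat
    proof -
      have "real_of_int (int n) \<le> real_of_int (C * N ^ L)" using that(2) by (rule of_int_le_iff[THEN iffD2])
      then have "real n powr \<delta> \<le> (real_of_int C * ?n ^ L) powr \<delta>"
        using \<delta> by (intro powr_mono2) auto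
      then have "Cd * real n powr \<delta> \<le> Cd * (real_of_int C * ?n ^ L) powr \<delta>"
        using Cd(1) by (intro mult_left_mono) auto
      then show ?thesis
        unfolding M_def using Cd(2)[OF that(1)] by (intro le_nat_floor) linarith
    qed
    let ?bad = "{(x, y) \<in> nondiag k d N. card (y ` {1..k} - x ` {1..k}) < r}"
    let ?good = "{(x, y) \<in> nondiag k d N. r \<le> card (y ` {1..k} - x ` {1..k})}"
    have "?bad \<union> ?good = nondiag k d N" by auto
    with card_Un_le[of ?bad ?good] have "card (nondiag k d N) \<le> card ?bad + card ?good"
      by (simp only:)
    then have split: "real (card (nondiag k d N)) \<le> real (card ?bad) + real (card ?good)"
      by (simp only: of_nat_add[symmetric] of_nat_le_iff)
    have "real (card ?bad) \<le> real ((2 * k ^ k * (r - 1 + d) ^ k) * nat N ^ (r + d))"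
      using card_nondiag_degenerate[OF d r N] by (rule of_nat_mono)
    also have "\<dots> = c1 * ?n powr (real r + real d)"
      using n by (simp add: c1_def powr_realpow flip: of_nat_add)
    also have "\<dots> \<le> c1 * ?n powr (real r + real d + real k / real r + \<epsilon>)"
      using n(1) \<epsilon> by (intro mult_left_mono powr_mono) (auto simp: c1_def)
    finally have bad: "real (card ?bad) \<le> c1 * ?n powr (real r + real d + real k / real r + \<epsilon>)" .
    let ?b = "card {B. 0 < B \<and> B ^ r \<le> N ^ k}"
    have b: "real ?b \<le> ?n powr (real k / real r)"
      using card_bounded_powers_le[OF _ N, of r k] r by simp
    have "real M \<le> Cd * (real_of_int C * ?n ^ L) powr \<delta>"
      unfolding M_def using M0 by simp
    also have "\<dots> = (Cd * real_of_int C powr \<delta>) * ?n powr (L * \<delta>)"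
      using n C by (simp add: powr_mult powr_powr flip: powr_realpow)
    finally have "(2 * real M) ^ k \<le> (2 * ((Cd * real_of_int C powr \<delta>) * ?n powr (L * \<delta>))) ^ k"
      by (intro power_mono) auto
    also have "\<dots> = (2 * (Cd * real_of_int C powr \<delta>)) ^ k * (?n powr (L * \<delta>)) ^ k"
      by (simp add: power_mult_distrib mult_ac)
    also have "(?n powr (L * \<delta>)) ^ k = ?n powr \<epsilon>"
      using n L k by (simp add: powr_powr \<delta>_def flip: powr_realpow)
    finally have Mk: "(2 * real M) ^ k \<le> (2 * (Cd * real_of_int C powr \<delta>)) ^ k * ?n powr \<epsilon>" .
    have "card ?good \<le> (nat N ^ r * r) * ?b * nat (3 * C * N ^ d) * ((2 * M) ^ k * k ^ k)"
      by (rule card_nondiag_nondegenerate[OF d r N C_def]) (rule M, auto simp: L_def)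
    then have "real (card ?good) \<le>
        real ((nat N ^ r * r) * ?b * nat (3 * C * N ^ d) * ((2 * M) ^ k * k ^ k))"
      by (rule of_nat_mono)
    also have "\<dots> = (?n ^ r * real r) * real ?b * (3 * real_of_int C * ?n ^ d) *
        ((2 * real M) ^ k * real (k ^ k))"
      using n C N by (simp add: C_def)
    also have "\<dots> \<le> (?n ^ r * real r) * ?n powr (real k / real r) * (3 * real_of_int C * ?n ^ d) *
        ((2 * (Cd * real_of_int C powr \<delta>)) ^ k * ?n powr \<epsilon> * real (k ^ k))"
      using b Mk C n Cd(1) by (intro mult_mono mult_nonneg_nonneg) auto
    also have "\<dots> = c2 * (?n ^ r * ?n ^ d * ?n powr (real k / real r) * ?n powr \<epsilon>)"
      by (simp add: c2_def mult_ac)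
    also have "?n ^ r * ?n ^ d * ?n powr (real k / real r) * ?n powr \<epsilon> =
        ?n powr (real r + real d + real k / real r + \<epsilon>)"
      using n by (simp add: powr_add powr_realpow)
    finally show ?thesis using split bad by (simp add: algebra_simps)
  qed
  moreover have "c1 + c2 \<ge> 0" using Cd C by (simp add: c1_def c2_def)
  ultimately show ?thesis by blast
qed

section \<open>Passage from non-diagonal solutions to the counting functions\<close>

lemma box_tuples_eq: "box_tuples k X = {1..k} \<rightarrow>\<^sub>E {1..\<lfloor>X\<rfloor>}"
  by (auto simp: box_tuples_def le_floor_iff intro!: PiE_cong)

text \<open>Permuted tuples have equal power sums of every order and equal root polynomials, so the
  solutions are the disjoint union of the diagonal and the non-diagonal ones.\<close>

lemma I_count_eq: "I_count k d X = T_count k X + card (nondiag k d \<lfloor>X\<rfloor>)"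
proof -
  let ?B = "{1..k} \<rightarrow>\<^sub>E {1..\<lfloor>X\<rfloor>}"
  define I where "I = {(x, y). x \<in> ?B \<and> y \<in> ?B \<and>
     (\<forall>j. 1 \<le> j \<and> j \<le> k \<and> j \<noteq> k - d \<longrightarrow> (\<Sum>i=1..k. x i ^ j) = (\<Sum>i=1..k. y i ^ j))}"
  define T where "T = {(x, y). x \<in> ?B \<and> y \<in> ?B \<and>
     (\<exists>\<sigma>. \<sigma> permutes {1..k} \<and> (\<forall>i\<in>{1..k}. x i = y (\<sigma> i)))}"
  have T: "(\<Sum>i=1..k. x i ^ j) = (\<Sum>i=1..k. y i ^ j)" "root_poly {1..k} x = root_poly {1..k} y"
    if xy: "(x, y) \<in> T" for x y j
  proof -
    obtain \<sigma> where \<sigma>: "\<sigma> permutes {1..k}" "\<And>i. i \<in> {1..k} \<Longrightarrow> x i = y (\<sigma> i)"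
      using xy by (auto simp: T_def)
    have "(\<Sum>i=1..k. x i ^ j) = (\<Sum>i=1..k. y (\<sigma> i) ^ j)" by (intro sum.cong) (auto simp: \<sigma>)
    also have "\<dots> = (\<Sum>i=1..k. y i ^ j)"
      using sum.permute[OF \<sigma>(1), of "\<lambda>i. y i ^ j"] by (simp add: o_def)
    finally show "(\<Sum>i=1..k. x i ^ j) = (\<Sum>i=1..k. y i ^ j)" .
    have "root_poly {1..k} x = (\<Prod>i\<in>{1..k}. [:- y (\<sigma> i), 1:])"
      unfolding root_poly_def by (intro prod.cong) (auto simp: \<sigma>)
    also have "\<dots> = root_poly {1..k} y"
      using prod.permute[OF \<sigma>(1), of "\<lambda>i. [:- y i, 1:]"] by (simp add: o_def root_poly_def)
    finally show "root_poly {1..k} x = root_poly {1..k} y" .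
  qed
  have "I = T \<union> nondiag k d \<lfloor>X\<rfloor>"
  proof (intro equalityI subsetI; clarify)
    fix x y assume "(x, y) \<in> I" "(x, y) \<notin> nondiag k d \<lfloor>X\<rfloor>"
    then show "(x, y) \<in> T"
      using root_poly_eq_imp_permutes[of "{1..k}" x y] unfolding I_def T_def nondiag_def by simp
  next
    fix x y assume "(x, y) \<in> T \<union> nondiag k d \<lfloor>X\<rfloor>"
    then consider "(x, y) \<in> T" | "(x, y) \<in> nondiag k d \<lfloor>X\<rfloor>" by blast
    then show "(x, y) \<in> I"
    proof cases
      case 1
      then have "x \<in> ?B" "y \<in> ?B" by (auto simp: T_def)
      then show ?thesis using T(1)[OF 1] by (simp add: I_def)
    qed (auto simp: I_def nondiag_def)
  qed
  moreover have "T \<inter> nondiag k d \<lfloor>X\<rfloor> = {}"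
    using T(2) by (fastforce simp: nondiag_def)
  moreover have "finite T"
    by (rule finite_subset[of _ "?B \<times> ?B"]) (auto simp: T_def intro!: finite_PiE)
  ultimately have "card I = card T + card (nondiag k d \<lfloor>X\<rfloor>)"
    by (simp add: card_Un_disjoint finite_nondiag)
  then show ?thesis
    by (simp add: I_count_def T_count_def box_tuples_eq I_def T_def)
qed

theorem theorem1p1:
  fixes k d :: nat and \<epsilon> :: real
  assumes "k \<ge> 3" and "real d < real k / 2" and "\<epsilon> > 0"
  shows "\<exists>c :: real. \<forall>X :: real. X \<ge> 1 \<longrightarrow>
    \<bar>real (I_count k d X) - real (T_count k X)\<bar> \<le> c * X powr (gamma_exp k d + \<epsilon>)"
proof -
  define f where "f r = real r + real k / real r + (\<Sum>l=1..r. max (real d - real l + 1) 0)" for r :: nat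
  \<comment> \<open>The minimum over a finite nonempty range is attained; the bound is applied with
    a minimising \<open>r\<close> only.\<close>
  have "gamma_exp k d \<in> f ` {2..k}"
    unfolding gamma_exp_def f_def using assms(1) by (intro Min_in) auto
  then obtain r where r: "r \<in> {2..k}" "gamma_exp k d = f r" by blast
  have "max (real d - real 1 + 1) 0 \<le> (\<Sum>l=1..r. max (real d - real l + 1) 0)"
    using r(1) by (intro member_le_sum) auto
  then have le: "real r + real d + real k / real r + \<epsilon> \<le> gamma_exp k d + \<epsilon>"
    by (simp add: r(2) f_def)
  have "2 * d < k" using assms(2) by linarith
  then obtain c where c: "c \<ge> 0" "\<And>N::int. N \<ge> 1 \<Longrightarrow>
      real (card (nondiag k d N)) \<le> c * real_of_int N powr (real r + real d + real k / real r + \<epsilon>)"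
    using card_nondiag_le[of d k r \<epsilon>] r(1) assms(3) by auto
  have "\<bar>real (I_count k d X) - real (T_count k X)\<bar> \<le> c * X powr (gamma_exp k d + \<epsilon>)"
    if X: "X \<ge> 1" for X
  proof -
    have "\<bar>real (I_count k d X) - real (T_count k X)\<bar> = real (card (nondiag k d \<lfloor>X\<rfloor>))"
      by (simp add: I_count_eq)
    also have "\<dots> \<le> c * real_of_int \<lfloor>X\<rfloor> powr (real r + real d + real k / real r + \<epsilon>)"
      using X by (intro c(2)) simp
    also have "\<dots> \<le> c * X powr (real r + real d + real k / real r + \<epsilon>)"
      using c(1) X assms(3) by (intro mult_left_mono powr_mono2) auto
    also have "\<dots> \<le> c * X powr (gamma_exp k d + \<epsilon>)"
      using c(1) X le by (intro mult_left_mono powr_mono) auto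
    finally show ?thesis .
  qed
  then show ?thesis by blast
qed

end
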